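(* Let $k\ge1$ and $n\ge3$ be integers. (a) The following are $s$-symmetric $2k$-cycles in $U_{n,k}$: - the `symmetrized tori' $P\times Q+Q\times P$ for vertex-disjoint $k$-octahedra $P,Q$ in $[n]^{*k+1}$; - $U_{3,k}$. (b) Any $s$-symmetric $2k$-cycle in $U_{n,k}$ is a sum (modulo 2) of some of the $2k$-cycles described in (a).
   Context: $[n]=\{1,\dots,n\}$. $[n]^{*k+1}$ is the $k$-dimensional simplicial complex with vertex set $\{0,\dots,k\}\times[n]$ in which every $k+1$ vertices with pairwise different first coordinates span a $k$-simplex; $[3]^{*k+1}\subset[n]^{*k+1}$ is the subcomplex on the vertices $\{0,\dots,k\}\times[3]$. A $k$-octahedron in $[n]^{*k+1}$ is the set of $k$-faces of a subcomplex isomorphic to $[2]^{*k+1}$; such a subcomplex is determined by 2-element subsets $P_0,\dots,P_k\subset[n]$, its vertex set being $\bigsqcup_i\{i\}\times P_i$. For a finite simplicial $k$-complex $K$ let $E_k=E_k(K)$ be the set of its closed $k$-faces; $K^2=K\times K$ has the standard product cell structure, whose $2k$-cells are the elements of $E_k^2$. A $2k$-cycle in $K^2$ is a subset $C\subset E_k^2$ such that every $(2k-1)$-cell of $K^2$ is contained in an even number of $2k$-cells from $C$; equivalently, for every $(k-1)$-face $a$ and $k$-face $\beta$ of $K$, there is an even number of $k$-faces $\alpha\supset a$ with $(\alpha,\beta)\in C$, and an even number of $k$-faces $\alpha\supset a$ with $(\beta,\alpha)\in C$. Sums of cycles are modulo 2 (symmetric difference). A $2k$-cycle is ($s$-)symmetric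 if it is preserved by the involution $s$ switching the two factors, $s(\sigma,\tau)=(\tau,\sigma)$. The combinatorial deleted product is $K^{\times2}_\Delta:=\{(\sigma,\tau)\in E_k^2:\sigma\cap\tau=\varnothing\}$, and $U_{n,k}:=([n]^{*k+1})^{\times2}_\Delta$. A $2k$-cycle in $K^{\times 2}_\Delta$ is a $2k$-cycle $C$ in $K^2$ with $C\subset K^{\times2}_\Delta$. For sets $P,Q$ of $k$-faces, $P\times Q=\{(\sigma,\tau):\sigma\in P,\tau\in Q\}$. *)

theory Defs
  imports Main
begin

text \<open>A finite simplicial complex is given by the set of its nonempty faces, a face being the
  set of its vertices. A cell \<open>\<sigma> \<times> \<tau>\<close> of the product \<open>K\<^sup>2\<close> is represented by the pair
  \<open>(\<sigma>, \<tau>)\<close> of faces.\<close>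

definition finite_complex :: "'a set set \<Rightarrow> bool" where
  "finite_complex K \<longleftrightarrow>
     finite K \<and> (\<forall>\<sigma>\<in>K. finite \<sigma> \<and> \<sigma> \<noteq> {}) \<and> (\<forall>\<sigma>\<in>K. \<forall>\<tau>. \<tau> \<subseteq> \<sigma> \<and> \<tau> \<noteq> {} \<longrightarrow> \<tau> \<in> K)"

definition face_dim :: "'a set \<Rightarrow> nat" where
  "face_dim \<sigma> = card \<sigma> - 1"

definition faces :: "nat \<Rightarrow> 'a set set \<Rightarrow> 'a set set" where
  "faces d K = {\<sigma> \<in> K. face_dim \<sigma> = d}"

definition subcomplex :: "'a set set \<Rightarrow> 'a set set \<Rightarrow> bool" where
  "subcomplex L K \<longleftrightarrow> finite_complex L \<and> L \<subseteq> K"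

definition complex_isomorphic :: "'a set set \<Rightarrow> 'b set set \<Rightarrow> bool" where
  "complex_isomorphic K L \<longleftrightarrow> (\<exists>f. bij_betw f (\<Union>K) (\<Union>L) \<and> (\<lambda>\<sigma>. f ` \<sigma>) ` K = L)"

definition product_cells :: "nat \<Rightarrow> 'a set set \<Rightarrow> ('a set \<times> 'a set) set" where
  "product_cells d K = {(\<sigma>, \<tau>). \<sigma> \<in> K \<and> \<tau> \<in> K \<and> face_dim \<sigma> + face_dim \<tau> = d}"

text \<open>The following is meant for complexes \<open>K\<close> of dimension \<open>k \<ge> 1\<close>: only then are the
  \<open>2k\<close>-cells of \<open>K\<^sup>2\<close> exactly the pairs of \<open>k\<close>-faces.\<close>

definition product_cycle :: "nat \<Rightarrow> 'a set set \<Rightarrow> ('a set \<times> 'a set) set \<Rightarrow> bool" where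
  "product_cycle k K C \<longleftrightarrow>
     C \<subseteq> faces k K \<times> faces k K \<and>
     (\<forall>(a, b) \<in> product_cells (2 * k - 1) K. even (card {(\<alpha>, \<beta>) \<in> C. a \<subseteq> \<alpha> \<and> b \<subseteq> \<beta>}))"

definition deleted_product :: "nat \<Rightarrow> 'a set set \<Rightarrow> ('a set \<times> 'a set) set" where
  "deleted_product k K = {(\<sigma>, \<tau>) \<in> faces k K \<times> faces k K. \<sigma> \<inter> \<tau> = {}}"

definition swap_symmetric :: "('a \<times> 'a) set \<Rightarrow> bool" where
  "swap_symmetric C \<longleftrightarrow> prod.swap ` C = C"

definition mod2_sum :: "'a set set \<Rightarrow> 'a set" where
  "mod2_sum F = {x. odd (card {A \<in> F. x \<in> A})}"

text \<open>\<open>join_complex n k\<close> is $[n]^{*k+1}$.\<close>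

definition join_complex :: "nat \<Rightarrow> nat \<Rightarrow> (nat \<times> nat) set set" where
  "join_complex n k =
     {\<sigma>. \<sigma> \<noteq> {} \<and> (\<exists>\<tau>. \<sigma> \<subseteq> \<tau> \<and> \<tau> \<subseteq> {0..k} \<times> {1..n} \<and> card \<tau> = k + 1 \<and> inj_on fst \<tau>)}"

definition U :: "nat \<Rightarrow> nat \<Rightarrow> ((nat \<times> nat) set \<times> (nat \<times> nat) set) set" where
  "U n k = deleted_product k (join_complex n k)"

definition octahedron :: "nat \<Rightarrow> nat \<Rightarrow> (nat \<times> nat) set set \<Rightarrow> bool" where
  "octahedron n k P \<longleftrightarrow>
     (\<exists>L. subcomplex L (join_complex n k) \<and> complex_isomorphic L (join_complex 2 k) \<and>
          P = faces k L)"

definition vertex_disjoint :: "'a set set \<Rightarrow> 'a set set \<Rightarrow> bool" where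
  "vertex_disjoint P Q \<longleftrightarrow> \<Union>P \<inter> \<Union>Q = {}"

definition symmetrized_torus :: "'a set \<Rightarrow> 'a set \<Rightarrow> ('a \<times> 'a) set" where
  "symmetrized_torus P Q = sym_diff (P \<times> Q) (Q \<times> P)"

definition symmetric_cycle_in_U ::
    "nat \<Rightarrow> nat \<Rightarrow> ((nat \<times> nat) set \<times> (nat \<times> nat) set) set \<Rightarrow> bool" where
  "symmetric_cycle_in_U n k C \<longleftrightarrow>
     product_cycle k (join_complex n k) C \<and> C \<subseteq> U n k \<and> swap_symmetric C"

definition basic_cycles :: "nat \<Rightarrow> nat \<Rightarrow> ((nat \<times> nat) set \<times> (nat \<times> nat) set) set set" where
  "basic_cycles n k =
     {symmetrized_torus P Q |P Q. octahedron n k P \<and> octahedron n k Q \<and> vertex_disjoint P Q} \<union>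
     {U 3 k}"

lemma mod2_sum_empty: "mod2_sum {} = {}"
  by (simp add: mod2_sum_def)

lemma mod2_sum_insert:
  assumes "finite F" "A \<notin> F"
  shows "mod2_sum (insert A F) = sym_diff A (mod2_sum F)"
proof -
  have "{B \<in> insert A F. x \<in> B} = (if x \<in> A then insert A {B \<in> F. x \<in> B} else {B \<in> F. x \<in> B})" for x
    by auto
  then show ?thesis
    using assms by (auto simp: mod2_sum_def)
qed

lemma join_complex_subset: "join_complex n k \<subseteq> Pow ({0..k} \<times> {1..n})"
  by (auto simp: join_complex_def)

lemma finite_join_complex: "finite (join_complex n k)"
  by (rule finite_subset[OF join_complex_subset]) simp

lemma finite_complex_join_complex: "finite_complex (join_complex n k)"
proof -
  have fin: "finite \<sigma>" if "\<sigma> \<in> join_complex n k" for \<sigma>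
    by (rule finite_subset[of _ "{0..k} \<times> {1..n}"]) (use that join_complex_subset[of n k] in blast, simp)
  have ne: "\<sigma> \<noteq> {}" if "\<sigma> \<in> join_complex n k" for \<sigma>
    using that by (simp add: join_complex_def)
  have sub: "\<tau> \<in> join_complex n k" if "\<sigma> \<in> join_complex n k" "\<tau> \<subseteq> \<sigma>" "\<tau> \<noteq> {}" for \<sigma> \<tau>
    using that unfolding join_complex_def mem_Collect_eq by (meson subset_trans)
  show ?thesis
    unfolding finite_complex_def using finite_join_complex[of n k] fin ne sub by blast
qed

lemma face_dim_join_complex:
  assumes "\<sigma> \<in> join_complex n k"
  shows "face_dim \<sigma> \<le> k"
proof -
  obtain \<tau> where "\<sigma> \<subseteq> \<tau>" "card \<tau> = k + 1"
    using assms by (auto simp: join_complex_def)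
  then have "card \<sigma> \<le> k + 1"
    by (metis add_is_0 card.infinite card_mono one_neq_zero)
  then show ?thesis
    by (simp add: face_dim_def)
qed

text \<open>The two descriptions of \<open>2k\<close>-cycles agree.\<close>

lemma product_cycle_iff:
  assumes K: "finite_complex K" and dim: "\<And>\<sigma>. \<sigma> \<in> K \<Longrightarrow> face_dim \<sigma> \<le> k" and k: "k \<ge> 1"
  shows "product_cycle k K C \<longleftrightarrow>
     C \<subseteq> faces k K \<times> faces k K \<and>
     (\<forall>a \<in> faces (k - 1) K. \<forall>\<beta> \<in> faces k K.
        even (card {\<alpha> \<in> faces k K. a \<subseteq> \<alpha> \<and> (\<alpha>, \<beta>) \<in> C}) \<and>
        even (card {\<alpha> \<in> faces k K. a \<subseteq> \<alpha> \<and> (\<beta>, \<alpha>) \<in> C}))"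
proof (cases "C \<subseteq> faces k K \<times> faces k K")
  case True
  have cells: "product_cells (2 * k - 1) K =
      faces (k - 1) K \<times> faces k K \<union> faces k K \<times> faces (k - 1) K"
  proof (intro set_eqI iffI)
    fix x assume "x \<in> product_cells (2 * k - 1) K"
    then obtain \<sigma> \<tau> where x: "x = (\<sigma>, \<tau>)" "\<sigma> \<in> K" "\<tau> \<in> K" "face_dim \<sigma> + face_dim \<tau> = 2 * k - 1"
      by (auto simp: product_cells_def)
    with dim[of \<sigma>] dim[of \<tau>] k
    have "face_dim \<sigma> = k - 1 \<and> face_dim \<tau> = k \<or> face_dim \<sigma> = k \<and> face_dim \<tau> = k - 1"
      by linarith
    with x show "x \<in> faces (k - 1) K \<times> faces k K \<union> faces k K \<times> faces (k - 1) K"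
      by (auto simp: faces_def)
  qed (use k in \<open>auto simp: product_cells_def faces_def\<close>)
  have top: "\<beta> \<subseteq> \<alpha> \<longleftrightarrow> \<beta> = \<alpha>" if "\<alpha> \<in> faces k K" "\<beta> \<in> faces k K" for \<alpha> \<beta>
  proof -
    have "finite \<alpha>" "\<alpha> \<noteq> {}" "finite \<beta>" "\<beta> \<noteq> {}" "card \<alpha> - 1 = k" "card \<beta> - 1 = k"
      using that K by (simp_all add: faces_def face_dim_def finite_complex_def)
    then have "finite \<alpha>" "card \<alpha> = card \<beta>"
      using card_gt_0_iff[of \<alpha>] card_gt_0_iff[of \<beta>] by auto
    then show ?thesis
      by (metis card_subset_eq order_refl)
  qed
  have 1: "card {(\<alpha>, \<beta>') \<in> C. a \<subseteq> \<alpha> \<and> \<beta> \<subseteq> \<beta>'} = card {\<alpha> \<in> faces k K. a \<subseteq> \<alpha> \<and> (\<alpha>, \<beta>) \<in> C}"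
    if "\<beta> \<in> faces k K" for a \<beta>
  proof -
    have "{(\<alpha>, \<beta>') \<in> C. a \<subseteq> \<alpha> \<and> \<beta> \<subseteq> \<beta>'} = (\<lambda>\<alpha>. (\<alpha>, \<beta>)) ` {\<alpha> \<in> faces k K. a \<subseteq> \<alpha> \<and> (\<alpha>, \<beta>) \<in> C}"
      using True top that by blast
    then show ?thesis
      by (simp add: card_image inj_on_def)
  qed
  have 2: "card {(\<alpha>, \<beta>') \<in> C. \<beta> \<subseteq> \<alpha> \<and> a \<subseteq> \<beta>'} = card {\<alpha> \<in> faces k K. a \<subseteq> \<alpha> \<and> (\<beta>, \<alpha>) \<in> C}"
    if "\<beta> \<in> faces k K" for a \<beta>
  proof -
    have "{(\<alpha>, \<beta>') \<in> C. \<beta> \<subseteq> \<alpha> \<and> a \<subseteq> \<beta>'} = (\<lambda>\<alpha>. (\<beta>, \<alpha>)) ` {\<alpha> \<in> faces k K. a \<subseteq> \<alpha> \<and> (\<beta>, \<alpha>) \<in> C}"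
      using True top that by blast
    then show ?thesis
      by (simp add: card_image inj_on_def)
  qed
  have "product_cycle k K C \<longleftrightarrow>
      (\<forall>a \<in> faces (k - 1) K. \<forall>\<beta> \<in> faces k K.
        even (card {(\<alpha>, \<beta>') \<in> C. a \<subseteq> \<alpha> \<and> \<beta> \<subseteq> \<beta>'}) \<and> even (card {(\<alpha>, \<beta>') \<in> C. \<beta> \<subseteq> \<alpha> \<and> a \<subseteq> \<beta>'}))"
    using True unfolding product_cycle_def cells by blast
  then show ?thesis
    using True by (simp add: 1 2)
qed (simp add: product_cycle_def)

end

theory Submission
  imports Defs
begin

text \<open>A pair of disjoint \<open>k\<close>-faces is a word of \<open>k + 1\<close> arcs \<open>(x, y)\<close>, \<open>x \<noteq> y\<close>, and the cycle
  condition says that, in each position separately, all row and column sums vanish. So the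
  \<open>2k\<close>-cycles in \<open>U n k\<close> form the \<open>(k + 1)\<close>-st tensor power of the cycle space \<open>Z\<close> of the
  bipartite graph \<open>K(n,n)\<close> minus a perfect matching. Squares \<open>{r, a} \<times> {1, y}\<close> together with
  their transposes reduce the first factor of a symmetric cycle to the hexagon on \<open>{1, 2, 3}\<close>,
  and the coefficient of the hexagon is again symmetric. By induction a symmetric cycle is a sum of
  elements \<open>x + s x\<close> and possibly the power of the hexagon, which is \<open>U 3 k\<close>. For \<open>n \<ge> 4\<close> the hexagon
  is a sum of three squares, so that every \<open>x\<close> is a sum of products of squares, and
  the elements \<open>x + s x\<close> are sums of symmetrized tori; for \<open>n = 3\<close> the hexagon spans \<open>Z\<close>.\<close>

section \<open>Sums modulo 2\<close>

text \<open>The span over the field with two elements. Sums are built one generator at a time, which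
  permits induction; unlike in \<open>mod2_sum\<close>, a generator may be repeated.\<close>

inductive_set mod2_span :: "'a set set \<Rightarrow> 'a set set" for B where
  empty: "{} \<in> mod2_span B"
| add: "b \<in> B \<Longrightarrow> A \<in> mod2_span B \<Longrightarrow> sym_diff b A \<in> mod2_span B"

lemma sym_diff_assoc: "sym_diff (sym_diff A B) C = sym_diff A (sym_diff B C)"
  by blast

lemma mod2_span_base: "b \<in> B \<Longrightarrow> b \<in> mod2_span B"
  using mod2_span.add[OF _ mod2_span.empty] by fastforce

lemma mod2_span_sym_diff:
  "X \<in> mod2_span B \<Longrightarrow> Y \<in> mod2_span B \<Longrightarrow> sym_diff X Y \<in> mod2_span B"
  by (induction rule: mod2_span.induct) (simp_all add: sym_diff_assoc mod2_span.add)

text \<open>Additive maps need only be checked on generators. This serves for prefixing a factor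
  with \<open>cons_prod\<close>, for \<open>symmetrize\<close>, and for the passage from words to
  cells.\<close>

lemma mod2_span_map:
  assumes "X \<in> mod2_span B"
    and "L {} = {}" and "\<And>X Y. L (sym_diff X Y) = sym_diff (L X) (L Y)"
    and "\<And>b. b \<in> B \<Longrightarrow> L b \<in> mod2_span B'"
  shows "L X \<in> mod2_span B'"
  using assms(1) by induction (simp_all add: assms mod2_span.empty mod2_span_sym_diff)

lemma mod2_span_imp_mod2_sum:
  assumes "X \<in> mod2_span B"
  shows "\<exists>F. finite F \<and> F \<subseteq> B \<and> X = mod2_sum F"
  using assms
proof induction
  case empty
  then show ?case by (intro exI[of _ "{}"]) (simp add: mod2_sum_empty)
next
  case (add b A)
  then obtain F where F: "finite F" "F \<subseteq> B" "A = mod2_sum F" by blast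
  show ?case
  \<comment> \<open>\<open>F\<close> is a set, so a generator that occurs already has to be removed
    instead of added: the two copies cancel.\<close>
  proof (cases "b \<in> F")
    case True
    have "mod2_sum F = sym_diff b (mod2_sum (F - {b}))"
      using mod2_sum_insert[of "F - {b}" b] F(1) True by (simp add: insert_absorb)
    then have "sym_diff b A = mod2_sum (F - {b})"
      using F(3) by blast
    then show ?thesis using F by (intro exI[of _ "F - {b}"]) auto
  next
    case False
    then have "sym_diff b A = mod2_sum (insert b F)"
      using mod2_sum_insert[of F b] F by simp
    then show ?thesis using F add.hyps by (intro exI[of _ "insert b F"]) auto
  qed
qed

lemma even_card_sym_diff:
  assumes "finite A" "finite B"
  shows "even (card (sym_diff A B)) \<longleftrightarrow> (even (card A) \<longleftrightarrow> even (card B))"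
proof -
  have "card (sym_diff A B) = card (A - B) + card (B - A)"
    using assms by (intro card_Un_disjoint) auto
  moreover have "card A = card (A - B) + card (A \<inter> B)"
    using assms card_Diff_subset_Int[of A B] card_mono[of A "A \<inter> B"] by simp
  moreover have "card B = card (B - A) + card (A \<inter> B)"
    using assms card_Diff_subset_Int[of B A] card_mono[of B "A \<inter> B"] by (simp add: Int_commute)
  ultimately show ?thesis by presburger
qed

section \<open>Tensor powers of the cycle space\<close>

definition arcs :: "nat \<Rightarrow> (nat \<times> nat) set" where
  "arcs n = {(x, y). x \<in> {1..n} \<and> y \<in> {1..n} \<and> x \<noteq> y}"

definition words :: "nat \<Rightarrow> nat \<Rightarrow> (nat \<times> nat) list set" where
  "words n m = {w. length w = m \<and> set w \<subseteq> arcs n}"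

text \<open>\<open>w\<close> ranges over all lists of length \<open>m\<close>, not only over
  \<open>words n m\<close>, so the entry to be overwritten may be an arbitrary placeholder. The sets
  counted are finite because \<open>C\<close> consists of words over \<open>arcs n\<close>.\<close>

definition tensor_cycle :: "nat \<Rightarrow> nat \<Rightarrow> (nat \<times> nat) list set \<Rightarrow> bool" where
  "tensor_cycle n m C \<longleftrightarrow> C \<subseteq> words n m \<and>
     (\<forall>w i. length w = m \<longrightarrow> i < m \<longrightarrow>
        even (card {x. w[i := (x, snd (w ! i))] \<in> C}) \<and>
        even (card {y. w[i := (fst (w ! i), y)] \<in> C}))"

text \<open>The coefficient of the arc \<open>e\<close> in an expansion along the first tensor
  factor; \<open>cons_prod\<close> is the matching tensor product.\<close>

definition slice :: "'a \<Rightarrow> 'a list set \<Rightarrow> 'a list set" where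
  "slice e C = {w. e # w \<in> C}"

definition cons_prod :: "'a set \<Rightarrow> 'a list set \<Rightarrow> 'a list set" where
  "cons_prod X D = {e # w |e w. e \<in> X \<and> w \<in> D}"

text \<open>The involution \<open>s\<close> on words: interchanging the two faces reverses every
  arc.\<close>

definition flip :: "('a \<times> 'a) list set \<Rightarrow> ('a \<times> 'a) list set" where
  "flip C = {w. map prod.swap w \<in> C}"

definition symmetrize :: "('a \<times> 'a) list set \<Rightarrow> ('a \<times> 'a) list set" where
  "symmetrize C = sym_diff C (flip C)"

text \<open>The 4-cycles of the bipartite graph with edge set \<open>arcs n\<close>. Each is one
  coordinate of a pair of vertex-disjoint octahedra.\<close>

definition squares :: "nat \<Rightarrow> (nat \<times> nat) set set" where
  "squares n = {{p, q} \<times> {u, v} |p q u v.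
     {p, q, u, v} \<subseteq> {1..n} \<and> p \<noteq> q \<and> u \<noteq> v \<and> {p, q} \<inter> {u, v} = {}}"

primrec tori :: "nat \<Rightarrow> nat \<Rightarrow> (nat \<times> nat) list set set" where
  "tori n 0 = {{[]}}"
| "tori n (Suc m) = {cons_prod T D |T D. T \<in> squares n \<and> D \<in> tori n m}"

section \<open>Membership rules and additivity\<close>

lemma in_slice [simp]: "w \<in> slice e C \<longleftrightarrow> e # w \<in> C"
  by (simp add: slice_def)

lemma in_cons_prod [simp]: "e # w \<in> cons_prod X D \<longleftrightarrow> e \<in> X \<and> w \<in> D" "[] \<notin> cons_prod X D"
  by (auto simp: cons_prod_def)

lemma in_flip [simp]: "w \<in> flip C \<longleftrightarrow> map prod.swap w \<in> C"
  by (simp add: flip_def)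

lemma in_words_Cons [simp]: "e # w \<in> words n (Suc m) \<longleftrightarrow> e \<in> arcs n \<and> w \<in> words n m"
  by (auto simp: words_def)

lemma in_arcs [simp]: "(x, y) \<in> arcs n \<longleftrightarrow> x \<in> {1..n} \<and> y \<in> {1..n} \<and> x \<noteq> y"
  by (simp add: arcs_def)

lemma list_set_eqI:
  assumes "[] \<in> A \<longleftrightarrow> [] \<in> B" and "\<And>e w. e # w \<in> A \<longleftrightarrow> e # w \<in> B"
  shows "A = B"
proof (rule set_eqI)
  show "w \<in> A \<longleftrightarrow> w \<in> B" for w
    by (cases w) (simp_all add: assms)
qed

lemma cons_prod_sym_diff_right: "cons_prod X (sym_diff A B) = sym_diff (cons_prod X A) (cons_prod X B)"
  by (rule list_set_eqI) auto

lemma cons_prod_sym_diff_left: "cons_prod (sym_diff X Y) A = sym_diff (cons_prod X A) (cons_prod Y A)"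
  by (rule list_set_eqI) auto

lemma flip_cons_prod: "flip (cons_prod X D) = cons_prod (X\<inverse>) (flip D)"
  by (rule list_set_eqI) auto

lemma flip_flip [simp]: "flip (flip C) = C"
  by (auto simp: flip_def comp_def)

lemma flip_sym_diff: "flip (sym_diff A B) = sym_diff (flip A) (flip B)"
  by auto

lemma symmetrize_sym_diff: "symmetrize (sym_diff A B) = sym_diff (symmetrize A) (symmetrize B)"
  unfolding symmetrize_def by auto

text \<open>In the reduction of a symmetric cycle, this identifies the correction along a transposed
  square with the flip of the correction along the square.\<close>

lemma flip_slice:
  assumes "flip C = C"
  shows "slice (prod.swap e) C = flip (slice e C)"
proof -
  have "slice (prod.swap e) (flip C) = flip (slice e C)" by auto
  then show ?thesis by (simp only: assms)
qed

section \<open>Squares and the hexagon as graph cycles\<close>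

lemma squaresI:
  "{p, q, u, v} \<subseteq> {1..n} \<Longrightarrow> p \<noteq> q \<Longrightarrow> u \<noteq> v \<Longrightarrow> {p, q} \<inter> {u, v} = {} \<Longrightarrow>
    {p, q} \<times> {u, v} \<in> squares n"
  unfolding squares_def by (rule CollectI, intro exI conjI) (rule refl)

lemma squares_converse:
  assumes "T \<in> squares n"
  shows "T\<inverse> \<in> squares n"
proof -
  obtain p q u v where T: "T = {p, q} \<times> {u, v}" and *: "{p, q, u, v} \<subseteq> {1..n}" "p \<noteq> q" "u \<noteq> v"
      "{p, q} \<inter> {u, v} = {}"
    using assms unfolding squares_def by blast
  have "{u, v} \<times> {p, q} \<in> squares n" by (rule squaresI) (use * in auto)
  then show ?thesis by (simp only: T converse_Times)
qed

lemma squares_subset_arcs: "T \<in> squares n \<Longrightarrow> T \<subseteq> arcs n"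
  unfolding squares_def by auto

lemma squares_even:
  assumes "T \<in> squares n"
  shows "even (card {x. (x, y) \<in> T})" "even (card {x. (y, x) \<in> T})"
proof -
  obtain p q u v where T: "T = {p, q} \<times> {u, v}" "p \<noteq> q" "u \<noteq> v"
    using assms by (auto simp: squares_def)
  then have "{x. (x, y) \<in> T} = (if y \<in> {u, v} then {p, q} else {})"
    "{x. (y, x) \<in> T} = (if y \<in> {p, q} then {u, v} else {})"
    by auto
  with T show "even (card {x. (x, y) \<in> T})" "even (card {x. (y, x) \<in> T})"
    by simp_all
qed

lemma arcs3_even: "even (card {x. (x, y) \<in> arcs 3})" "even (card {x. (y, x) \<in> arcs 3})"
proof -
  have "{x. (x, y) \<in> arcs 3} = (if y \<in> {1..3} then {1..3} - {y} else {})"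
    "{x. (y, x) \<in> arcs 3} = (if y \<in> {1..3} then {1..3} - {y} else {})"
    by auto
  then show "even (card {x. (x, y) \<in> arcs 3})" "even (card {x. (y, x) \<in> arcs 3})"
    by (simp_all add: card_Diff_singleton)
qed

section \<open>Closure properties of tensor cycles\<close>

lemma tensor_cycle_subset: "tensor_cycle n m C \<Longrightarrow> C \<subseteq> words n m"
  by (simp add: tensor_cycle_def)

lemma tensor_cycle_even:
  assumes "tensor_cycle n (Suc m) C"
  shows "even (card {x. (x, y) # w \<in> C})" "even (card {x. (y, x) # w \<in> C})"
proof -
  have *: "length w = m" if "e # w \<in> C" for e
    using that tensor_cycle_subset[OF assms] by (force simp: words_def)
  have "even (card {x. (x, y) # w \<in> C}) \<and> even (card {x. (y, x) # w \<in> C})"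
  proof (cases "length w = m")
    case True
    \<comment> \<open>The head \<open>(y, y)\<close> is a placeholder: position 0 is overwritten,
      and having \<open>y\<close> in both components yields both parities from one instance.\<close>
    then show ?thesis
      using assms[unfolded tensor_cycle_def, THEN conjunct2, rule_format, of "(y, y) # w" 0] by simp
  next
    case False
    then have "{x. (x, y) # w \<in> C} = {}" "{x. (y, x) # w \<in> C} = {}"
      using * by auto
    then show ?thesis by simp
  qed
  then show "even (card {x. (x, y) # w \<in> C})" "even (card {x. (y, x) # w \<in> C})"
    by auto
qed

lemma tensor_cycle_slice:
  assumes "tensor_cycle n (Suc m) C"
  shows "tensor_cycle n m (slice e C)"
proof -
  have "slice e C \<subseteq> words n m"
    using tensor_cycle_subset[OF assms] by fastforce
  moreover have "even (card {x. w[i := (x, snd (w ! i))] \<in> slice e C}) \<and>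
        even (card {y. w[i := (fst (w ! i), y)] \<in> slice e C})"
    if "length w = m" "i < m" for w i
    using assms[unfolded tensor_cycle_def, THEN conjunct2, rule_format, of "e # w" "Suc i"] that
    by simp
  ultimately show ?thesis by (simp add: tensor_cycle_def)
qed

text \<open>Parity of \<open>card\<close> is additive for symmetric differences of finite sets; this
  supplies the finiteness.\<close>

lemma finite_updates:
  assumes "C \<subseteq> words n m" "i < length w"
  shows "finite {x. w[i := (x, b)] \<in> C}" "finite {x. w[i := (b, x)] \<in> C}"
proof -
  have "x \<in> {1..n}" if "w[i := (x, b)] \<in> C \<or> w[i := (b, x)] \<in> C" for x
    using that assms set_update_memI[OF assms(2), of "(x, b)"] set_update_memI[OF assms(2), of "(b, x)"]
    by (fastforce simp: words_def)
  then have "{x. w[i := (x, b)] \<in> C} \<subseteq> {1..n}" "{x. w[i := (b, x)] \<in> C} \<subseteq> {1..n}"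
    by auto
  then show "finite {x. w[i := (x, b)] \<in> C}" "finite {x. w[i := (b, x)] \<in> C}"
    by (meson finite_atLeastAtMost finite_subset)+
qed

lemma tensor_cycle_sym_diff:
  assumes "tensor_cycle n m C" "tensor_cycle n m D"
  shows "tensor_cycle n m (sym_diff C D)"
proof -
  note sub = assms[THEN tensor_cycle_subset]
  have "even (card {x. w[i := (x, snd (w ! i))] \<in> sym_diff C D}) \<and>
        even (card {y. w[i := (fst (w ! i), y)] \<in> sym_diff C D})"
    if w: "length w = m" "i < m" for w i
  proof -
    have "{x. w[i := (x, snd (w ! i))] \<in> sym_diff C D} =
        sym_diff {x. w[i := (x, snd (w ! i))] \<in> C} {x. w[i := (x, snd (w ! i))] \<in> D}"
      "{x. w[i := (fst (w ! i), x)] \<in> sym_diff C D} =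
        sym_diff {x. w[i := (fst (w ! i), x)] \<in> C} {x. w[i := (fst (w ! i), x)] \<in> D}"
      by auto
    then show ?thesis
      using assms w finite_updates[OF sub(1)] finite_updates[OF sub(2)]
      by (simp add: even_card_sym_diff tensor_cycle_def)
  qed
  with sub show ?thesis unfolding tensor_cycle_def by blast
qed

text \<open>Position 0 tests only the graph cycle \<open>X\<close>, the later positions test only
  \<open>D\<close>.\<close>

lemma tensor_cycle_cons_prod:
  assumes "X \<subseteq> arcs n" and "\<And>y. even (card {x. (x, y) \<in> X})" and "\<And>y. even (card {x. (y, x) \<in> X})"
    and D: "tensor_cycle n m D"
  shows "tensor_cycle n (Suc m) (cons_prod X D)"
proof -
  have "cons_prod X D \<subseteq> words n (Suc m)"
    using assms(1) tensor_cycle_subset[OF D] unfolding cons_prod_def by force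
  moreover have "even (card {x. w[i := (x, snd (w ! i))] \<in> cons_prod X D}) \<and>
        even (card {y. w[i := (fst (w ! i), y)] \<in> cons_prod X D})"
    if w: "length w = Suc m" "i < Suc m" for w i
  proof -
    obtain e v where ev: "w = e # v" "length v = m" using w(1) by (metis length_Suc_conv)
    show ?thesis
    proof (cases i)
      case 0
      then show ?thesis using ev assms(2,3) by (cases "v \<in> D") simp_all
    next
      case (Suc j)
      then show ?thesis
        using ev D w by (cases "e \<in> X") (simp_all add: tensor_cycle_def)
    qed
  qed
  ultimately show ?thesis unfolding tensor_cycle_def by blast
qed

lemma tensor_cycle_cons_square:
  "T \<in> squares n \<Longrightarrow> tensor_cycle n m D \<Longrightarrow> tensor_cycle n (Suc m) (cons_prod T D)"
  using tensor_cycle_cons_prod squares_subset_arcs squares_even by metis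

lemma tensor_cycle_cons_arcs3:
  "n \<ge> 3 \<Longrightarrow> tensor_cycle n m D \<Longrightarrow> tensor_cycle n (Suc m) (cons_prod (arcs 3) D)"
  by (rule tensor_cycle_cons_prod) (use arcs3_even in auto)

lemma tensor_cycle_empty_word: "tensor_cycle n 0 C \<longleftrightarrow> C \<subseteq> {[]}"
  by (auto simp: tensor_cycle_def words_def)

lemma words_Suc: "words n (Suc m) = cons_prod (arcs n) (words n m)"
  by (rule list_set_eqI) (auto simp: words_def)

lemma words_0: "words n 0 = {[]}"
  by (auto simp: words_def)

lemma tensor_cycle_words3: "n \<ge> 3 \<Longrightarrow> tensor_cycle n m (words 3 m)"
  by (induction m) (simp_all add: words_0 tensor_cycle_empty_word words_Suc tensor_cycle_cons_arcs3)

lemma tensor_cycle_tori: "T \<in> tori n m \<Longrightarrow> tensor_cycle n m T"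
  by (induction m arbitrary: T) (auto simp: tensor_cycle_empty_word tensor_cycle_cons_square)

text \<open>The arcs on three vertices form a hexagon, so their cycle space is one-dimensional.\<close>

lemma tensor_cycle_arcs3:
  assumes C: "tensor_cycle n (Suc m) C" and supp: "\<And>e w. e # w \<in> C \<Longrightarrow> e \<in> arcs 3"
  shows "C = cons_prod (arcs 3) (slice (1, 2) C)"
proof (rule list_set_eqI)
  show "[] \<in> C \<longleftrightarrow> [] \<in> cons_prod (arcs 3) (slice (1, 2) C)"
    using tensor_cycle_subset[OF C] by (auto simp: words_def)
next
  fix e :: "nat \<times> nat" and w
  \<comment> \<open>Only two arcs of the hexagon meet at a vertex, and an even number of them in
    \<open>C\<close> means both or neither. \<open>f\<close> lists the candidate arcs at that
    vertex.\<close>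
  have pair: "a # w \<in> C \<longleftrightarrow> b # w \<in> C"
    if "a \<noteq> b" "even (card (Collect (\<lambda>x. f x # w \<in> C)))" "f x = a" "f y = b"
      "\<And>z. f z \<in> arcs 3 \<Longrightarrow> z = x \<or> z = y" for a b x y and f :: "nat \<Rightarrow> nat \<times> nat"
  proof -
    have "z = x \<or> z = y" if "f z # w \<in> C" for z
      using supp[OF that] \<open>\<And>z. f z \<in> arcs 3 \<Longrightarrow> z = x \<or> z = y\<close> by blast
    then have "Collect (\<lambda>z. f z # w \<in> C) =
        (if a # w \<in> C then {x} else {}) \<union> (if b # w \<in> C then {y} else {})"
      using that(3,4) by auto
    moreover have "x \<noteq> y" using that by blast
    ultimately show ?thesis using that(2) by (cases "a # w \<in> C"; cases "b # w \<in> C") simp_all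
  qed
  have *: "z = 1 \<or> z = 2 \<or> z = 3" if "z \<in> {1..3}" for z :: nat using that by force
  \<comment> \<open>The five relations join the six arcs in one path 21, 23, 13, 12, 32, 31, so all
    six have the same coefficient.\<close>
  have r1: "(1, 2) # w \<in> C \<longleftrightarrow> (1, 3) # w \<in> C"
    by (rule pair[where f = "\<lambda>x. (1, x)" and x = 2 and y = 3]) (use tensor_cycle_even[OF C] in auto)
  have r2: "(2, 1) # w \<in> C \<longleftrightarrow> (2, 3) # w \<in> C"
    by (rule pair[where f = "\<lambda>x. (2, x)" and x = 1 and y = 3]) (use tensor_cycle_even[OF C] in auto)
  have r3: "(3, 1) # w \<in> C \<longleftrightarrow> (3, 2) # w \<in> C"
    by (rule pair[where f = "\<lambda>x. (3, x)" and x = 1 and y = 2]) (use tensor_cycle_even[OF C] in auto)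
  have c2: "(1, 2) # w \<in> C \<longleftrightarrow> (3, 2) # w \<in> C"
    by (rule pair[where f = "\<lambda>x. (x, 2)" and x = 1 and y = 3]) (use tensor_cycle_even[OF C] in auto)
  have c3: "(1, 3) # w \<in> C \<longleftrightarrow> (2, 3) # w \<in> C"
    by (rule pair[where f = "\<lambda>x. (x, 3)" and x = 1 and y = 2]) (use tensor_cycle_even[OF C] in auto)
  show "e # w \<in> C \<longleftrightarrow> e # w \<in> cons_prod (arcs 3) (slice (1, 2) C)"
  proof (cases "e \<in> arcs 3")
    case True
    then obtain x y where "e = (x, y)" "x \<in> {1..3}" "y \<in> {1..3}" "x \<noteq> y" by (cases e) auto
    with *[of x] *[of y] r1 r2 r3 c2 c3 True show ?thesis by auto
  next
    case False
    then show ?thesis using supp[of e w] by (simp, blast)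
  qed
qed

text \<open>Elimination in the first factor: the square \<open>{r, a} \<times> {1, y}\<close> and its transpose clear the
  arcs \<open>(r, y)\<close> and \<open>(y, r)\<close>; once this is done for all \<open>y \<ge> 2\<close>, the parity condition clears
  \<open>(r, 1)\<close> and \<open>(1, r)\<close>, so that the vertex \<open>r\<close> is no longer used.\<close>

lemma tensor_cycle_reduction:
  assumes C: "tensor_cycle n (Suc m) C" and n: "n \<ge> 3"
    and base: "\<And>D. tensor_cycle n m D \<Longrightarrow> P (cons_prod (arcs 3) D)"
    and step: "\<And>C T e. tensor_cycle n (Suc m) C \<Longrightarrow> T \<in> squares n \<Longrightarrow>
      P (sym_diff C (sym_diff (cons_prod T (slice e C)) (cons_prod (T\<inverse>) (slice (prod.swap e) C)))) \<Longrightarrow> P C"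
  shows "P C"
proof -
  \<comment> \<open>Induction on the number \<open>r\<close> of vertices that may occur in the first
    factor; at \<open>r = 3\<close> only the hexagon remains.\<close>
  have main: "P C" if "r \<ge> 3" "r \<le> n" "tensor_cycle n (Suc m) C" "\<And>e w. e # w \<in> C \<Longrightarrow> e \<in> arcs r" for r C
    using that
  proof (induction r arbitrary: C rule: nat_induct_at_least)
    case base
    then show ?case using tensor_cycle_arcs3 assms(3) tensor_cycle_slice by metis
  next
    case (Suc r)
    \<comment> \<open>The arcs between \<open>Suc r\<close> and every \<open>y\<close> with
      \<open>2 \<le> y < j\<close> are already cleared. The induction descends from
      \<open>j = Suc r\<close>, where the clearing is complete, and obtains case \<open>j\<close>
      from case \<open>Suc j\<close> for the corrected cycle.\<close>
    have "P C" if "j \<le> Suc r" "2 \<le> j" "tensor_cycle n (Suc m) C" "\<And>e w. e # w \<in> C \<Longrightarrow> e \<in> arcs (Suc r)"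
      "\<And>y w. 2 \<le> y \<Longrightarrow> y < j \<Longrightarrow> (Suc r, y) # w \<notin> C \<and> (y, Suc r) # w \<notin> C" for j C
      using that
    proof (induction j arbitrary: C rule: inc_induct)
      case base
      \<comment> \<open>Only the neighbour 1 is left, and a set with at most one element and even
        cardinality is empty.\<close>
      have row: "(Suc r, 1) # w \<notin> C" "(1, Suc r) # w \<notin> C" for w
      proof -
        have "y = 1" if "(Suc r, y) # w \<in> C \<or> (y, Suc r) # w \<in> C" for y
          using base.prems(3)[of "(Suc r, y)" w] base.prems(3)[of "(y, Suc r)" w] base.prems(4)[of y w] that
          by force
        then have "{x. (Suc r, x) # w \<in> C} = (if (Suc r, 1) # w \<in> C then {1} else {})"
          "{x. (x, Suc r) # w \<in> C} = (if (1, Suc r) # w \<in> C then {1} else {})"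
          by auto
        then show "(Suc r, 1) # w \<notin> C" "(1, Suc r) # w \<notin> C"
          using tensor_cycle_even[OF base.prems(2), of "Suc r" w] by (auto split: if_splits)
      qed
      show ?case
      proof (rule Suc.IH)
        fix e w assume ew: "e # w \<in> C"
        obtain x y where e: "e = (x, y)" by fastforce
        have "x \<noteq> Suc r" "y \<noteq> Suc r"
          using base.prems(3)[OF ew] base.prems(4)[of y w] base.prems(4)[of x w] row[of w] ew e
          by (cases "y = 1"; cases "x = 1"; force)+
        then show "e \<in> arcs r" using base.prems(3)[OF ew] e by auto
      qed (use Suc.prems base.prems in auto)
    next
      case (step j)
      \<comment> \<open>The fourth vertex of the square must avoid 1, \<open>j\<close> and
        \<open>Suc r\<close>; since \<open>r \<ge> 3\<close>, one of 2 and 3 does.\<close>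
      define a where "a = (if j = 2 then 3 else 2 :: nat)"
      define T where "T = {Suc r, a} \<times> {1, j}"
      have T: "T \<in> squares n"
        unfolding T_def using step.prems step.hyps Suc.hyps Suc.prems
        by (intro squaresI) (auto simp: a_def)
      let ?e = "(Suc r, j)"
      let ?C = "sym_diff C (sym_diff (cons_prod T (slice ?e C)) (cons_prod (T\<inverse>) (slice (prod.swap ?e) C)))"
      have TS: "T \<subseteq> arcs (Suc r)" "T\<inverse> \<subseteq> arcs (Suc r)"
        unfolding T_def using step.prems step.hyps Suc.hyps by (auto simp: a_def)
      have "P ?C"
      proof (rule step.IH)
        show "2 \<le> Suc j" using step.prems by simp
        show "tensor_cycle n (Suc m) ?C"
          by (intro tensor_cycle_sym_diff tensor_cycle_cons_square T squares_converse
              tensor_cycle_slice step.prems)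
        show "e \<in> arcs (Suc r)" if "e # w \<in> ?C" for e w
          using that TS step.prems(3)[of e w] by auto
        show "(Suc r, y) # w \<notin> ?C \<and> (y, Suc r) # w \<notin> ?C" if "2 \<le> y" "y < Suc j" for y w
        proof (cases "y = j")
          \<comment> \<open>\<open>T\<close> contains \<open>(Suc r, j)\<close> but not its reverse,
            so each of the two coefficients is cancelled exactly once.\<close>
          case True
          then show ?thesis using step.hyps step.prems(1) Suc.hyps
            by (auto simp: T_def a_def)
        next
          case False
          then have "(Suc r, y) \<notin> T" "(Suc r, y) \<notin> T\<inverse>" "(y, Suc r) \<notin> T" "(y, Suc r) \<notin> T\<inverse>"
            using that step.hyps step.prems(1) Suc.hyps by (auto simp: T_def a_def)
          then show ?thesis using step.prems(4)[of y w] that False by auto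
        qed
      qed
      then show ?case using assms(4)[OF step.prems(2) T] by blast
    qed
    \<comment> \<open>At \<open>j = 2\<close> no arc is required to be cleared yet.\<close>
    from this[of 2 C] show ?case using Suc by auto
  qed
  show ?thesis
    by (rule main[OF n order_refl C]) (use tensor_cycle_subset[OF C] in auto)
qed

section \<open>Generators of all cycles and of the symmetric cycles\<close>

lemma hexagon_eq_squares:
  "arcs 3 = sym_diff ({4, 1} \<times> {2, 3}) (sym_diff ({4, 2} \<times> {1, 3}) ({4, 3} \<times> {1, 2}))"
proof -
  have "{1..3} = {1, 2, 3 :: nat}" by auto
  then have "arcs 3 = {(1, 2), (1, 3), (2, 1), (2, 3), (3, 1), (3, 2)}"
    unfolding arcs_def by auto
  moreover have "{a, b} \<times> {c, d} = {(a, c), (a, d), (b, c), (b, d)}" for a b c d :: nat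
    by auto
  \<comment> \<open>Every arc leaving 4 lies in exactly two of the squares and cancels; the other
    six arcs form the hexagon.\<close>
  ultimately show ?thesis by (simp add: insert_Diff_if insert_commute)
qed

text \<open>The reduction leaves products whose first factor is a square or the hexagon. The fourth
  vertex splits the hexagon into squares, and the remaining factors are handled by induction on the
  length.\<close>

lemma tensor_cycle_in_span_tori:
  assumes "tensor_cycle n m C" "n \<ge> 4"
  shows "C \<in> mod2_span (tori n m)"
  using assms(1)
proof (induction m arbitrary: C)
  case 0
  then have "C = {} \<or> C = {[]}" by (auto simp: tensor_cycle_empty_word)
  then show ?case using mod2_span.empty mod2_span_base by auto
next
  case (Suc m)
  have cons: "cons_prod T D \<in> mod2_span (tori n (Suc m))" if "T \<in> squares n" "tensor_cycle n m D" for T D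
    by (rule mod2_span_map[where L = "cons_prod T", OF Suc.IH[OF that(2)]])
      (use that(1) in \<open>auto simp: cons_prod_def[of _ "{}"] cons_prod_sym_diff_right intro: mod2_span_base\<close>)
  show ?case
  proof (rule tensor_cycle_reduction[OF Suc.prems])
    fix D assume D: "tensor_cycle n m D"
    have "{4, 1} \<times> {2, 3} \<in> squares n" "{4, 2} \<times> {1, 3} \<in> squares n" "{4, 3} \<times> {1, 2} \<in> squares n"
      using assms(2) by (intro squaresI; simp)+
    then show "cons_prod (arcs 3) D \<in> mod2_span (tori n (Suc m))"
      unfolding hexagon_eq_squares cons_prod_sym_diff_left
      by (intro mod2_span_sym_diff cons D)
  next
    fix C :: "(nat \<times> nat) list set" and T e
    let ?R = "sym_diff (cons_prod T (slice e C)) (cons_prod (T\<inverse>) (slice (prod.swap e) C))"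
    assume C: "tensor_cycle n (Suc m) C" and T: "T \<in> squares n"
      and red: "sym_diff C ?R \<in> mod2_span (tori n (Suc m))"
    have "?R \<in> mod2_span (tori n (Suc m))"
      by (intro mod2_span_sym_diff cons tensor_cycle_slice C T squares_converse)
    \<comment> \<open>Adding the correction a second time restores \<open>C\<close>.\<close>
    with red have "sym_diff (sym_diff C ?R) ?R \<in> mod2_span (tori n (Suc m))"
      by (rule mod2_span_sym_diff)
    moreover have "sym_diff (sym_diff C ?R) ?R = C" by blast
    ultimately show "C \<in> mod2_span (tori n (Suc m))" by simp
  qed (use assms in simp)
qed

text \<open>A tensor power of a one-dimensional space is one-dimensional, here spanned by the power
  of the hexagon.\<close>

lemma tensor_cycle_3:
  assumes "tensor_cycle 3 m C"
  shows "C = {} \<or> C = words 3 m"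
  using assms
proof (induction m arbitrary: C)
  case 0
  then show ?case by (auto simp: tensor_cycle_empty_word words_0)
next
  case (Suc m)
  have "C = cons_prod (arcs 3) (slice (1, 2) C)"
    by (rule tensor_cycle_arcs3[OF Suc.prems]) (use tensor_cycle_subset[OF Suc.prems] in auto)
  with Suc.IH[OF tensor_cycle_slice[OF Suc.prems, of "(1, 2)"]] show ?case
    by (metis cons_prod_sym_diff_right Diff_cancel Un_empty words_Suc)
qed

lemma symmetric_tensor_cycle_in_span:
  assumes "tensor_cycle n m C" "flip C = C" "n \<ge> 3"
  shows "C \<in> mod2_span (symmetrize ` tori n m \<union> {words 3 m})"
\<comment> \<open>Three vertices admit no square, so this case rests on the cycle space having a
  single nonzero element.\<close>
proof (cases "n = 3")
  case True
  with assms tensor_cycle_3 have "C = {} \<or> C = words 3 m" by blast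
  then show ?thesis using mod2_span.empty mod2_span_base by blast
next
  case False
  then have n: "n \<ge> 4" using assms by simp
  have sym: "symmetrize D \<in> mod2_span (symmetrize ` tori n m \<union> {words 3 m})"
    if "tensor_cycle n m D" for D m
    by (rule mod2_span_map[where L = symmetrize, OF tensor_cycle_in_span_tori[OF that n]])
      (auto simp: symmetrize_sym_diff mod2_span_base, auto simp: symmetrize_def)
  show ?thesis using assms(1,2)
  proof (induction m arbitrary: C)
    case 0
    \<comment> \<open>In length 0 the only nonzero cycle is \<open>words 3 0\<close>; the
      symmetrization of the torus \<open>{[]}\<close> is empty.\<close>
    then have "C = {} \<or> C = {[]}" by (auto simp: tensor_cycle_empty_word)
    then show ?case using mod2_span.empty mod2_span_base words_0 by (metis UnI2 insertI1)
  next
    case (Suc m)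
    let ?S = "mod2_span (symmetrize ` tori n (Suc m) \<union> {words 3 (Suc m)})"
    have conv: "(arcs 3)\<inverse> = arcs 3" by (auto simp: arcs_def)
    \<comment> \<open>Symmetry is part of the property proved by the reduction, because the cycle
      changes at each step and must be seen to stay symmetric.\<close>
    have "flip C = C \<longrightarrow> C \<in> ?S"
    proof (rule tensor_cycle_reduction[OF Suc.prems(1) assms(3)], rule_tac [!] impI)
      fix D assume D: "tensor_cycle n m D" and "flip (cons_prod (arcs 3) D) = cons_prod (arcs 3) D"
      \<comment> \<open>The hexagon equals its transpose, so comparing coefficients of the arc
        \<open>(1, 2)\<close> shows that \<open>D\<close> is symmetric.\<close>
      then have "(1, 2) # w \<in> cons_prod (arcs 3) (flip D) \<longleftrightarrow> (1, 2) # w \<in> cons_prod (arcs 3) D" for w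
        by (simp only: flip_cons_prod conv)
      moreover have "(1, 2) \<in> arcs 3" by simp
      ultimately have "flip D = D" by (intro set_eqI) (simp only: in_cons_prod simp_thms)
      from Suc.IH[OF D this] show "cons_prod (arcs 3) D \<in> ?S"
      proof (rule mod2_span_map[where L = "cons_prod (arcs 3)"])
        fix b assume "b \<in> symmetrize ` tori n m \<union> {words 3 m}"
        then consider (torus) T where "T \<in> tori n m" "b = symmetrize T" | (hexagon) "b = words 3 m"
          by blast
        then show "cons_prod (arcs 3) b \<in> ?S"
        proof cases
          case torus
          \<comment> \<open>Multiplication by the symmetric hexagon commutes with symmetrization.
            The result is the symmetrization of a cycle that need not be a torus, which is what
            \<open>sym\<close> covers.\<close>
          then have "cons_prod (arcs 3) b = symmetrize (cons_prod (arcs 3) T)"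
            by (simp add: symmetrize_def flip_cons_prod conv cons_prod_sym_diff_right)
          with torus sym[of "Suc m"] show ?thesis
            by (simp add: tensor_cycle_tori tensor_cycle_cons_arcs3 assms(3))
        next
          case hexagon
          then show ?thesis by (simp add: words_Suc mod2_span_base)
        qed
      qed (auto simp: cons_prod_sym_diff_right, auto simp: cons_prod_def)
    next
      fix C :: "(nat \<times> nat) list set" and T e
      let ?R = "sym_diff (cons_prod T (slice e C)) (cons_prod (T\<inverse>) (slice (prod.swap e) C))"
      assume C: "tensor_cycle n (Suc m) C" "flip C = C" and T: "T \<in> squares n"
        and imp: "flip (sym_diff C ?R) = sym_diff C ?R \<longrightarrow> sym_diff C ?R \<in> ?S"
      \<comment> \<open>\<open>flip\<close> exchanges the two halves of the correction. Being a
        symmetrization, it lies in the span by \<open>sym\<close>, and adding it keeps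
        \<open>C\<close> symmetric.\<close>
      have R: "?R = symmetrize (cons_prod T (slice e C))"
        by (simp add: symmetrize_def flip_cons_prod flip_slice[OF C(2)])
      have "flip ?R = ?R"
        unfolding R symmetrize_def flip_sym_diff flip_flip by blast
      then have "sym_diff C ?R \<in> ?S"
        using imp C(2) by (simp only: flip_sym_diff)
      moreover have "?R \<in> ?S"
        unfolding R by (intro sym tensor_cycle_cons_square T tensor_cycle_slice C)
      ultimately have "sym_diff (sym_diff C ?R) ?R \<in> ?S"
        by (rule mod2_span_sym_diff)
      moreover have "sym_diff (sym_diff C ?R) ?R = C" by blast
      ultimately show "C \<in> ?S" by simp
    qed
    with Suc.prems show ?case by blast
  qed
qed

section \<open>Simplices and words\<close>

definition simplex_of :: "'a list \<Rightarrow> (nat \<times> 'a) set" where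
  "simplex_of xs = (\<lambda>i. (i, xs ! i)) ` {..<length xs}"

text \<open>Letter \<open>i\<close> holds the vertices of both faces in coordinate \<open>i\<close>,
  so disjointness of the faces says that no letter is diagonal.\<close>

definition cell_of :: "(nat \<times> nat) list \<Rightarrow> (nat \<times> nat) set \<times> (nat \<times> nat) set" where
  "cell_of w = (simplex_of (map fst w), simplex_of (map snd w))"

lemma in_simplex_of [simp]: "(i, x) \<in> simplex_of xs \<longleftrightarrow> i < length xs \<and> x = xs ! i"
  by (auto simp: simplex_of_def)

lemma card_simplex_of [simp]: "card (simplex_of xs) = length xs"
  unfolding simplex_of_def by (subst card_image) (auto simp: inj_on_def)

lemma finite_simplex_of [simp]: "finite (simplex_of xs)"
  by (simp add: simplex_of_def)

lemma simplex_of_eq_iff [simp]: "simplex_of xs = simplex_of ys \<longleftrightarrow> xs = ys"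
proof
  assume eq: "simplex_of xs = simplex_of ys"
  then have len: "length xs = length ys" by (metis card_simplex_of)
  show "xs = ys"
  proof (rule nth_equalityI[OF len])
    show "xs ! i = ys ! i" if "i < length xs" for i
      using that in_simplex_of[of i "xs ! i" ys] in_simplex_of[of i "xs ! i" xs] unfolding eq by simp
  qed
qed simp

lemma inj_on_fst_simplex_of: "inj_on fst (simplex_of xs)"
  by (auto simp: simplex_of_def inj_on_def)

lemma simplex_of_disjoint_iff:
  "length xs = length ys \<Longrightarrow> simplex_of xs \<inter> simplex_of ys = {} \<longleftrightarrow> (\<forall>i<length xs. xs ! i \<noteq> ys ! i)"
  by (auto simp: simplex_of_def)

section \<open>Faces of the join complex as lists\<close>

lemma join_complex_eq:
  assumes "n \<ge> 1"
  shows "join_complex n k = {\<sigma>. \<sigma> \<noteq> {} \<and> \<sigma> \<subseteq> {0..k} \<times> {1..n} \<and> inj_on fst \<sigma>}"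
proof (intro set_eqI iffI)
  fix \<sigma> assume "\<sigma> \<in> {\<sigma>. \<sigma> \<noteq> {} \<and> \<sigma> \<subseteq> {0..k} \<times> {1..n} \<and> inj_on fst \<sigma>}"
  then have \<sigma>: "\<sigma> \<noteq> {}" "\<sigma> \<subseteq> {0..k} \<times> {1..n}" "inj_on fst \<sigma>" by auto
  \<comment> \<open>Coordinates missing from \<sigma> are filled with the vertex label 1, which
    exists since \<open>n \<ge> 1\<close>.\<close>
  define \<tau> where "\<tau> = \<sigma> \<union> (\<lambda>i. (i, 1)) ` ({0..k} - fst ` \<sigma>)"
  have inj: "inj_on fst \<tau>"
    using \<sigma>(3) unfolding \<tau>_def inj_on_def by (auto simp: rev_image_eqI)
  moreover have "fst ` \<tau> = {0..k}"
    using \<sigma>(2) unfolding \<tau>_def image_Un image_image by auto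
  ultimately have "card \<tau> = k + 1"
    by (metis card_image card_atLeastAtMost Suc_eq_plus1 diff_zero)
  moreover have "\<tau> \<subseteq> {0..k} \<times> {1..n}" "\<sigma> \<subseteq> \<tau>"
    using \<sigma>(2) assms unfolding \<tau>_def by auto
  ultimately show "\<sigma> \<in> join_complex n k"
    using \<sigma>(1) inj unfolding join_complex_def by blast
qed (auto simp: join_complex_def intro: inj_on_subset)

lemma card_face:
  assumes "\<sigma> \<in> faces d (join_complex n k)"
  shows "card \<sigma> = Suc d"
proof -
  have "\<sigma> \<noteq> {}" "finite \<sigma>" "card \<sigma> - 1 = d"
    using assms finite_complex_join_complex[of n k]
    by (auto simp: faces_def face_dim_def finite_complex_def)
  then show ?thesis using card_gt_0_iff[of \<sigma>] by simp
qed

lemma faces_join_complex: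
  assumes n: "n \<ge> 1"
  shows "faces k (join_complex n k) = simplex_of ` {xs. length xs = Suc k \<and> set xs \<subseteq> {1..n}}"
proof (intro set_eqI iffI)
  fix \<sigma> assume \<sigma>: "\<sigma> \<in> faces k (join_complex n k)"
  then have card: "card \<sigma> = Suc k" by (rule card_face)
  have sub: "\<sigma> \<subseteq> {0..k} \<times> {1..n}" and inj: "inj_on fst \<sigma>"
    using \<sigma> n by (simp_all add: faces_def join_complex_eq)
  have fin: "finite \<sigma>" using card card_eq_0_iff[of \<sigma>] by auto
  \<comment> \<open>By cardinality the injective projection hits every coordinate, so \<sigma> has
    one vertex in each and can be read as a list.\<close>
  have "fst ` \<sigma> = {0..k}"
    by (rule card_subset_eq) (use sub card card_image[OF inj] in auto)
  then have "\<forall>i\<in>{0..k}. \<exists>x. (i, x) \<in> \<sigma>" by force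
  then obtain g where g: "\<And>i. i \<le> k \<Longrightarrow> (i, g i) \<in> \<sigma>" by (metis atLeastAtMost_iff zero_le)
  define xs where "xs = map g [0..<Suc k]"
  have nth: "xs ! i = g i" if "i \<le> k" for i
    unfolding xs_def using that by (subst nth_map) (simp_all del: upt_Suc)
  have len: "length xs = Suc k" by (simp add: xs_def)
  have "simplex_of xs \<subseteq> \<sigma>"
    using g nth len by (auto simp: simplex_of_def less_Suc_eq_le)
  then have "simplex_of xs = \<sigma>"
    by (rule card_subset_eq[OF fin]) (simp add: len card)
  moreover have "set xs \<subseteq> {1..n}"
    using g sub by (fastforce simp: xs_def less_Suc_eq_le simp del: upt_Suc)
  ultimately show "\<sigma> \<in> simplex_of ` {xs. length xs = Suc k \<and> set xs \<subseteq> {1..n}}"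
    using len by blast
next
  fix \<sigma> assume "\<sigma> \<in> simplex_of ` {xs. length xs = Suc k \<and> set xs \<subseteq> {1..n}}"
  then obtain xs where xs: "\<sigma> = simplex_of xs" "length xs = Suc k" "set xs \<subseteq> {1..n}" by blast
  have "xs ! i \<in> {1..n}" if "i < Suc k" for i
    using xs that by (metis nth_mem subsetD)
  then have "\<sigma> \<subseteq> {0..k} \<times> {1..n}" using xs(1,2) by (auto simp: simplex_of_def)
  moreover have "\<sigma> \<noteq> {}" using xs by (auto simp: simplex_of_def)
  ultimately show "\<sigma> \<in> faces k (join_complex n k)"
    using xs n by (simp add: faces_def face_dim_def join_complex_eq inj_on_fst_simplex_of)
qed

text \<open>Naming a codimension-one face by a list and a deleted position matches the data
  \<open>w\<close>, \<open>i\<close> in \<open>tensor_cycle\<close>; the letter deleted is an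
  arbitrary choice.\<close>

lemma subface_eq:
  assumes "a \<in> faces (k - 1) (join_complex n k)" "k \<ge> 1" "n \<ge> 1"
  obtains xs i where "length xs = Suc k" "set xs \<subseteq> {1..n}" "i < Suc k" "a = simplex_of xs - {(i, xs ! i)}"
proof -
  have carda: "card a = k" using card_face[OF assms(1)] assms(2) by simp
  obtain \<tau> where \<tau>: "a \<subseteq> \<tau>" "\<tau> \<subseteq> {0..k} \<times> {1..n}" "card \<tau> = k + 1" "inj_on fst \<tau>"
    using assms(1) by (auto simp: faces_def join_complex_def)
  then have "\<tau> \<in> faces k (join_complex n k)"
    using assms(3) by (auto simp: faces_def face_dim_def join_complex_eq)
  then obtain xs where xs: "\<tau> = simplex_of xs" "length xs = Suc k" "set xs \<subseteq> {1..n}"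
    using faces_join_complex[OF assms(3)] by auto
  have "finite a" using \<tau>(1) xs(1) by (metis finite_simplex_of finite_subset)
  then have "card (\<tau> - a) = 1"
    using card_Diff_subset[of a \<tau>] \<tau>(1,3) carda by simp
  then obtain v where v: "\<tau> - a = {v}" by (auto simp: card_1_singleton_iff)
  then obtain i where i: "i < Suc k" "v = (i, xs ! i)"
    using xs by (auto simp: simplex_of_def)
  have "a = simplex_of xs - {(i, xs ! i)}" using v i \<tau>(1) xs(1) by blast
  then show ?thesis using that xs i by blast
qed

lemma subface_in_faces:
  assumes "length xs = Suc k" "set xs \<subseteq> {1..n}" "i < Suc k" "k \<ge> 1" "n \<ge> 1"
  shows "simplex_of xs - {(i, xs ! i)} \<in> faces (k - 1) (join_complex n k)"
proof -
  let ?a = "simplex_of xs - {(i, xs ! i)}"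
  have card: "card ?a = k" using assms by (simp add: card_Diff_singleton)
  then have "?a \<noteq> {}" using assms(4) by fastforce
  moreover have "simplex_of xs \<in> join_complex n k"
    using faces_join_complex[OF assms(5), of k] assms(1,2) by (auto simp: faces_def)
  ultimately have "?a \<in> join_complex n k"
    using finite_complex_join_complex[of n k] unfolding finite_complex_def by (metis Diff_subset)
  with card show ?thesis by (simp add: faces_def face_dim_def)
qed

lemma subface_subset_iff:
  assumes "length xs = length zs"
  shows "simplex_of xs - {(i, xs ! i)} \<subseteq> simplex_of zs \<longleftrightarrow> zs = xs[i := zs ! i]"
proof
  assume sub: "simplex_of xs - {(i, xs ! i)} \<subseteq> simplex_of zs"
  show "zs = xs[i := zs ! i]"
  proof (rule nth_equalityI)
    fix j assume "j < length zs"
    with sub assms show "zs ! j = xs[i := zs ! i] ! j"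
      by (cases "j = i") (auto dest!: subsetD[of _ _ "(j, xs ! j)"])
  qed (use assms in simp)
next
  assume eq: "zs = xs[i := zs ! i]"
  have "xs ! j = zs ! j" if "j \<noteq> i" for j
    using that by (subst eq) simp
  then show "simplex_of xs - {(i, xs ! i)} \<subseteq> simplex_of zs"
    using assms by (force simp: simplex_of_def)
qed

text \<open>Only the letter at position \<open>i\<close> is free, which turns a count of faces into
  a count of labels.\<close>

lemma faces_containing_subface:
  assumes "length xs = Suc k" "set xs \<subseteq> {1..n}" "i < Suc k" "n \<ge> 1"
  shows "{\<alpha> \<in> faces k (join_complex n k). simplex_of xs - {(i, xs ! i)} \<subseteq> \<alpha>} =
    (\<lambda>x. simplex_of (xs[i := x])) ` {1..n}"
proof (intro set_eqI iffI)
  fix \<alpha> assume "\<alpha> \<in> {\<alpha> \<in> faces k (join_complex n k). simplex_of xs - {(i, xs ! i)} \<subseteq> \<alpha>}"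
  then obtain zs where zs: "\<alpha> = simplex_of zs" "length zs = Suc k" "set zs \<subseteq> {1..n}"
      "simplex_of xs - {(i, xs ! i)} \<subseteq> simplex_of zs"
    using faces_join_complex[OF assms(4)] by auto
  then have "zs = xs[i := zs ! i]" using subface_subset_iff[of xs zs i] assms(1) by simp
  moreover have "zs ! i \<in> {1..n}" using zs(2,3) assms(3) nth_mem by (metis subsetD)
  ultimately show "\<alpha> \<in> (\<lambda>x. simplex_of (xs[i := x])) ` {1..n}"
    using zs(1) by (metis imageI)
next
  fix \<alpha> assume "\<alpha> \<in> (\<lambda>x. simplex_of (xs[i := x])) ` {1..n}"
  then obtain x where x: "\<alpha> = simplex_of (xs[i := x])" "x \<in> {1..n}" by blast
  have "set (xs[i := x]) \<subseteq> {1..n}"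
    using set_update_subset_insert[of xs i x] x(2) assms(2) by blast
  then have "\<alpha> \<in> faces k (join_complex n k)"
    using x(1) faces_join_complex[OF assms(4), of k] assms(1) by auto
  moreover have "simplex_of xs - {(i, xs ! i)} \<subseteq> \<alpha>"
    unfolding x(1) using assms(1,3) by (subst subface_subset_iff) simp_all
  ultimately show "\<alpha> \<in> {\<alpha> \<in> faces k (join_complex n k). simplex_of xs - {(i, xs ! i)} \<subseteq> \<alpha>}" by blast
qed

lemma inj_on_simplex_of_update: "i < length xs \<Longrightarrow> inj_on (\<lambda>x. simplex_of (xs[i := x])) A"
  by (auto simp: inj_on_def) (metis nth_list_update_eq)

section \<open>Cells of the deleted product as words\<close>

lemma inj_cell_of: "inj cell_of"
  by (rule injI) (auto simp: cell_of_def, metis zip_map_fst_snd)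

lemma cell_of_swap: "cell_of (map prod.swap w) = prod.swap (cell_of w)"
  by (simp add: cell_of_def comp_def)

lemma swap_cell_of_image: "prod.swap ` cell_of ` C = cell_of ` flip C"
proof -
  have "flip C = map prod.swap ` C"
    by (auto simp: comp_def image_iff intro!: bexI[of _ "map prod.swap _"])
  then show ?thesis by (simp add: image_image cell_of_swap)
qed

lemma simplex_pair_in_cell_image_iff:
  assumes "length xs = length ys"
  shows "(simplex_of xs, simplex_of ys) \<in> cell_of ` C \<longleftrightarrow> zip xs ys \<in> C"
proof -
  have "(simplex_of xs, simplex_of ys) = cell_of (zip xs ys)"
    using assms by (simp add: cell_of_def)
  then show ?thesis by (simp add: inj_image_mem_iff[OF inj_cell_of])
qed

lemma in_words_zip:
  assumes "length xs = m" "length ys = m"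
  shows "zip xs ys \<in> words n m \<longleftrightarrow>
    set xs \<subseteq> {1..n} \<and> set ys \<subseteq> {1..n} \<and> (\<forall>i<m. xs ! i \<noteq> ys ! i)"
proof -
  have "zip xs ys \<in> words n m \<longleftrightarrow> (\<forall>i<m. (xs ! i, ys ! i) \<in> arcs n)"
    using assms by (auto simp: words_def set_zip)
  also have "\<dots> \<longleftrightarrow> set xs \<subseteq> {1..n} \<and> set ys \<subseteq> {1..n} \<and> (\<forall>i<m. xs ! i \<noteq> ys ! i)"
    using assms by (simp only: in_arcs subset_iff all_set_conv_all_nth Ball_def[symmetric]) auto
  finally show ?thesis .
qed

lemma U_eq_cell_image:
  assumes "n \<ge> 1"
  shows "U n k = cell_of ` words n (Suc k)"
proof (intro set_eqI iffI)
  fix c assume "c \<in> U n k"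
  then obtain xs ys where xy: "c = (simplex_of xs, simplex_of ys)" "length xs = Suc k" "set xs \<subseteq> {1..n}"
      "length ys = Suc k" "set ys \<subseteq> {1..n}" "simplex_of xs \<inter> simplex_of ys = {}"
    unfolding U_def deleted_product_def faces_join_complex[OF assms] by auto
  then show "c \<in> cell_of ` words n (Suc k)"
    by (simp add: simplex_pair_in_cell_image_iff in_words_zip simplex_of_disjoint_iff)
next
  fix c assume "c \<in> cell_of ` words n (Suc k)"
  then obtain w where w: "c = cell_of w" "w \<in> words n (Suc k)" by blast
  then have "length w = Suc k" by (simp add: words_def)
  moreover have "zip (map fst w) (map snd w) \<in> words n (Suc k)"
    using w by (simp add: zip_map_fst_snd)
  ultimately show "c \<in> U n k"
    unfolding U_def deleted_product_def faces_join_complex[OF assms] w(1) cell_of_def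
    by (simp add: simplex_of_disjoint_iff in_words_zip)
qed

lemma product_cycle_join_complex_iff:
  assumes "k \<ge> 1"
  shows "product_cycle k (join_complex n k) C \<longleftrightarrow>
     C \<subseteq> faces k (join_complex n k) \<times> faces k (join_complex n k) \<and>
     (\<forall>a \<in> faces (k - 1) (join_complex n k). \<forall>\<beta> \<in> faces k (join_complex n k).
        even (card {\<alpha> \<in> faces k (join_complex n k). a \<subseteq> \<alpha> \<and> (\<alpha>, \<beta>) \<in> C}) \<and>
        even (card {\<alpha> \<in> faces k (join_complex n k). a \<subseteq> \<alpha> \<and> (\<beta>, \<alpha>) \<in> C}))"
  using finite_complex_join_complex face_dim_join_complex assms by (rule product_cycle_iff)

text \<open>A codimension-one face of \<open>xs\<close> at position \<open>i\<close>, paired with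
  the face of \<open>ys\<close>, tests the words obtained from \<open>zip xs ys\<close> by varying
  one component of letter \<open>i\<close>.\<close>

lemma product_cycle_cell_image_iff:
  assumes C: "C \<subseteq> words n (Suc k)" and k: "k \<ge> 1" and n: "n \<ge> 1"
  shows "product_cycle k (join_complex n k) (cell_of ` C) \<longleftrightarrow> tensor_cycle n (Suc k) C"
proof -
  let ?K = "join_complex n k"
  have sub: "cell_of ` C \<subseteq> faces k ?K \<times> faces k ?K"
    using U_eq_cell_image[OF n, of k] C by (auto simp: U_def deleted_product_def)
  have card1: "card {\<alpha> \<in> faces k ?K. simplex_of xs - {(i, xs ! i)} \<subseteq> \<alpha> \<and> (\<alpha>, simplex_of ys) \<in> cell_of ` C} =
      card {x. (zip xs ys)[i := (x, ys ! i)] \<in> C}"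
    and card2: "card {\<alpha> \<in> faces k ?K. simplex_of xs - {(i, xs ! i)} \<subseteq> \<alpha> \<and> (simplex_of ys, \<alpha>) \<in> cell_of ` C} =
      card {x. (zip ys xs)[i := (ys ! i, x)] \<in> C}"
    if xs: "length xs = Suc k" "set xs \<subseteq> {1..n}" and ys: "length ys = Suc k" and i: "i < Suc k" for xs ys i
  proof -
    let ?f = "\<lambda>x. simplex_of (xs[i := x])"
    have upd: "(zip xs ys)[i := (x, ys ! i)] = zip (xs[i := x]) ys"
      "(zip ys xs)[i := (ys ! i, x)] = zip ys (xs[i := x])" for x
      by (simp_all add: update_zip)
    \<comment> \<open>\<open>tensor_cycle\<close> counts over all natural numbers; only labels in
      \<open>{1..n}\<close> contribute, so the count agrees with that of faces.\<close>
    have range: "x \<in> {1..n}" if "zip (xs[i := x]) ys \<in> C \<or> zip ys (xs[i := x]) \<in> C" for x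
    proof -
      have "set (xs[i := x]) \<subseteq> {1..n}"
        using that C xs ys in_words_zip[of "xs[i := x]" "Suc k" ys n] in_words_zip[of ys "Suc k" "xs[i := x]" n]
        by auto
      then show ?thesis using set_update_memI[of i xs x] i xs by auto
    qed
    have "{\<alpha> \<in> faces k ?K. simplex_of xs - {(i, xs ! i)} \<subseteq> \<alpha> \<and> (\<alpha>, simplex_of ys) \<in> cell_of ` C} =
        {\<alpha> \<in> {\<alpha> \<in> faces k ?K. simplex_of xs - {(i, xs ! i)} \<subseteq> \<alpha>}. (\<alpha>, simplex_of ys) \<in> cell_of ` C}"
      by (simp only: mem_Collect_eq conj_assoc)
    also have "\<dots> = ?f ` {x \<in> {1..n}. (?f x, simplex_of ys) \<in> cell_of ` C}"
      unfolding faces_containing_subface[OF xs i n] by blast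
    also have "{x \<in> {1..n}. (?f x, simplex_of ys) \<in> cell_of ` C} = {x. zip (xs[i := x]) ys \<in> C}"
      using range xs ys by (subst simplex_pair_in_cell_image_iff) auto
    finally show "card {\<alpha> \<in> faces k ?K. simplex_of xs - {(i, xs ! i)} \<subseteq> \<alpha> \<and> (\<alpha>, simplex_of ys) \<in> cell_of ` C} =
        card {x. (zip xs ys)[i := (x, ys ! i)] \<in> C}"
      unfolding upd using card_image[OF inj_on_simplex_of_update, of i xs] xs i by simp
    have "{\<alpha> \<in> faces k ?K. simplex_of xs - {(i, xs ! i)} \<subseteq> \<alpha> \<and> (simplex_of ys, \<alpha>) \<in> cell_of ` C} =
        {\<alpha> \<in> {\<alpha> \<in> faces k ?K. simplex_of xs - {(i, xs ! i)} \<subseteq> \<alpha>}. (simplex_of ys, \<alpha>) \<in> cell_of ` C}"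
      by (simp only: mem_Collect_eq conj_assoc)
    also have "\<dots> = ?f ` {x \<in> {1..n}. (simplex_of ys, ?f x) \<in> cell_of ` C}"
      unfolding faces_containing_subface[OF xs i n] by blast
    also have "{x \<in> {1..n}. (simplex_of ys, ?f x) \<in> cell_of ` C} = {x. zip ys (xs[i := x]) \<in> C}"
      using range xs ys by (subst simplex_pair_in_cell_image_iff) auto
    finally show "card {\<alpha> \<in> faces k ?K. simplex_of xs - {(i, xs ! i)} \<subseteq> \<alpha> \<and> (simplex_of ys, \<alpha>) \<in> cell_of ` C} =
        card {x. (zip ys xs)[i := (ys ! i, x)] \<in> C}"
      unfolding upd using card_image[OF inj_on_simplex_of_update, of i xs] xs i by simp
  qed
  note iff = product_cycle_join_complex_iff[OF k]
  show ?thesis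
  proof
    assume L: "product_cycle k ?K (cell_of ` C)"
    have par: "even (card {x. (zip xs ys)[i := (x, ys ! i)] \<in> C})"
      "even (card {x. (zip ys xs)[i := (ys ! i, x)] \<in> C})"
      if xs: "length xs = Suc k" "set xs \<subseteq> {1..n}" and ys: "length ys = Suc k" "set ys \<subseteq> {1..n}"
        and i: "i < Suc k" for xs ys i
    proof -
      have "simplex_of ys \<in> faces k ?K"
        using ys faces_join_complex[OF n] by auto
      note L[unfolded iff, THEN conjunct2, rule_format, OF subface_in_faces[OF xs i k n] this]
      then show "even (card {x. (zip xs ys)[i := (x, ys ! i)] \<in> C})"
        "even (card {x. (zip ys xs)[i := (ys ! i, x)] \<in> C})"
        by (simp_all only: card1[OF xs ys(1) i] card2[OF xs ys(1) i])
    qed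
    \<comment> \<open>The lists of first and second components of \<open>w\<close> serve in opposite
      roles for the two parities.\<close>
    have word: "even (card {x. w[i := (x, snd (w ! i))] \<in> C}) \<and> even (card {x. w[i := (fst (w ! i), x)] \<in> C})"
      if w: "w \<in> words n (Suc k)" and i: "i < Suc k" for w i
    proof -
      have len: "length w = Suc k" using w by (simp add: words_def)
      have "set (map fst w) \<subseteq> {1..n}" "set (map snd w) \<subseteq> {1..n}"
        using w in_words_zip[of "map fst w" "Suc k" "map snd w" n] len by (simp_all add: zip_map_fst_snd)
      with par(1)[of "map fst w" "map snd w" i] par(2)[of "map snd w" "map fst w" i] len i
      show ?thesis by (simp add: zip_map_fst_snd)
    qed
    show "tensor_cycle n (Suc k) C"
      unfolding tensor_cycle_def
    proof (intro conjI allI impI C)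
      fix w :: "(nat \<times> nat) list" and i assume w: "length w = Suc k" "i < Suc k"
      show "even (card {x. w[i := (x, snd (w ! i))] \<in> C})"
      \<comment> \<open>\<open>w\<close> itself may fail to be a word over \<open>arcs n\<close>. If
        the set is nonempty, \<open>w\<close> can be replaced by an update lying in
        \<open>C\<close>, which defines the same set.\<close>
      proof (cases "{x. w[i := (x, snd (w ! i))] \<in> C} = {}")
        case False
        then obtain z where "w[i := (z, snd (w ! i))] \<in> C" by blast
        with word[of "w[i := (z, snd (w ! i))]" i] C w show ?thesis by auto
      next
        case True
        then show ?thesis by (simp only: card.empty even_zero)
      qed
      show "even (card {y. w[i := (fst (w ! i), y)] \<in> C})"
      proof (cases "{x. w[i := (fst (w ! i), x)] \<in> C} = {}")
        case False
        then obtain z where "w[i := (fst (w ! i), z)] \<in> C" by blast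
        with word[of "w[i := (fst (w ! i), z)]" i] C w show ?thesis by auto
      next
        case True
        then show ?thesis by (simp only: card.empty even_zero)
      qed
    qed
  next
    assume R: "tensor_cycle n (Suc k) C"
    show "product_cycle k ?K (cell_of ` C)"
      unfolding iff
    proof (intro conjI ballI sub)
      fix a \<beta> assume a: "a \<in> faces (k - 1) ?K" and \<beta>: "\<beta> \<in> faces k ?K"
      obtain xs i where xs: "length xs = Suc k" "set xs \<subseteq> {1..n}" and i: "i < Suc k"
        and a_eq: "a = simplex_of xs - {(i, xs ! i)}"
        using subface_eq[OF a k n] .
      obtain ys where ys: "\<beta> = simplex_of ys" "length ys = Suc k"
        using \<beta> faces_join_complex[OF n] by auto
      have "even (card {x. (zip xs ys)[i := (x, snd (zip xs ys ! i))] \<in> C})"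
        "even (card {x. (zip ys xs)[i := (fst (zip ys xs ! i), x)] \<in> C})"
        using R[unfolded tensor_cycle_def, THEN conjunct2, rule_format, of "zip xs ys" i]
          R[unfolded tensor_cycle_def, THEN conjunct2, rule_format, of "zip ys xs" i] i xs(1) ys(2)
        by simp_all
      then show "even (card {\<alpha> \<in> faces k ?K. a \<subseteq> \<alpha> \<and> (\<alpha>, \<beta>) \<in> cell_of ` C})"
        "even (card {\<alpha> \<in> faces k ?K. a \<subseteq> \<alpha> \<and> (\<beta>, \<alpha>) \<in> cell_of ` C})"
        unfolding a_eq ys(1) card1[OF xs ys(2) i] card2[OF xs ys(2) i] using xs ys i by simp_all
    qed
  qed
qed

section \<open>Octahedra\<close>

text \<open>The isomorphism transports the count to \<open>join_complex 2 k\<close>, where the free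
  letter has exactly two values.\<close>

lemma octahedron_even:
  assumes P: "octahedron n k P" and a: "a \<in> faces (k - 1) (join_complex n k)" and k: "k \<ge> 1"
  shows "even (card {\<alpha> \<in> P. a \<subseteq> \<alpha>})"
proof -
  let ?J = "join_complex 2 k"
  obtain L f where L: "finite_complex L" "L \<subseteq> join_complex n k" "P = faces k L"
    and f: "bij_betw f (\<Union>L) (\<Union>?J)" "(\<lambda>\<sigma>. f ` \<sigma>) ` L = ?J"
    using P by (auto simp: octahedron_def subcomplex_def complex_isomorphic_def)
  have inj: "inj_on f (\<Union>L)" using f(1) by (simp add: bij_betw_def)
  have card: "card (f ` \<sigma>) = card \<sigma>" if "\<sigma> \<in> L" for \<sigma>
    by (rule card_image) (use that in \<open>auto intro: inj_on_subset[OF inj]\<close>)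
  have subset: "f ` \<sigma> \<subseteq> f ` \<tau> \<longleftrightarrow> \<sigma> \<subseteq> \<tau>" if "\<sigma> \<in> L" "\<tau> \<in> L" for \<sigma> \<tau>
  proof -
    have "f x \<in> f ` \<tau> \<longleftrightarrow> x \<in> \<tau>" if "x \<in> \<sigma>" for x
      by (rule inj_on_image_mem_iff[OF inj]) (use that \<open>\<sigma> \<in> L\<close> \<open>\<tau> \<in> L\<close> in auto)
    then show ?thesis by blast
  qed
  show ?thesis
  proof (cases "a \<in> L")
    case False
    have "a \<noteq> {}" using card_face[OF a] by auto
    then have "{\<alpha> \<in> P. a \<subseteq> \<alpha>} = {}"
      using False L by (auto simp: faces_def finite_complex_def)
    then show ?thesis by (simp only: card.empty even_zero)
  next
    case True
    have "card a - 1 = k - 1" using a by (simp add: faces_def face_dim_def)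
    then have "f ` a \<in> faces (k - 1) ?J"
      using True f(2) card by (auto simp: faces_def face_dim_def)
    then obtain xs i where xs: "length xs = Suc k" "set xs \<subseteq> {1..2}" "i < Suc k"
        and fa: "f ` a = simplex_of xs - {(i, xs ! i)}"
      by (rule subface_eq[OF _ k]) simp
    have "(\<lambda>\<sigma>. f ` \<sigma>) ` {\<alpha> \<in> P. a \<subseteq> \<alpha>} = {\<alpha> \<in> faces k ?J. f ` a \<subseteq> \<alpha>}"
    proof (intro set_eqI iffI)
      fix \<beta> assume "\<beta> \<in> {\<alpha> \<in> faces k ?J. f ` a \<subseteq> \<alpha>}"
      then obtain \<alpha> where "\<alpha> \<in> L" "\<beta> = f ` \<alpha>" "face_dim \<beta> = k" "f ` a \<subseteq> f ` \<alpha>"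
        unfolding faces_def f(2)[symmetric] by blast
      then show "\<beta> \<in> (\<lambda>\<sigma>. f ` \<sigma>) ` {\<alpha> \<in> P. a \<subseteq> \<alpha>}"
        using L(3) True subset card by (auto simp: faces_def face_dim_def)
    qed (use L(3) f(2) card in \<open>auto simp: faces_def face_dim_def\<close>)
    also have "\<dots> = (\<lambda>x. simplex_of (xs[i := x])) ` {1..2}"
      unfolding fa by (rule faces_containing_subface[OF xs]) simp
    also have "card \<dots> = 2"
      using card_image[OF inj_on_simplex_of_update, of i xs "{1..2}"] xs by simp
    finally have "card ((\<lambda>\<sigma>. f ` \<sigma>) ` {\<alpha> \<in> P. a \<subseteq> \<alpha>}) = 2" .
    moreover have "inj_on (\<lambda>\<sigma>. f ` \<sigma>) {\<alpha> \<in> P. a \<subseteq> \<alpha>}"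
    proof (rule inj_onI)
      fix \<sigma> \<tau> assume "\<sigma> \<in> {\<alpha> \<in> P. a \<subseteq> \<alpha>}" "\<tau> \<in> {\<alpha> \<in> P. a \<subseteq> \<alpha>}" "f ` \<sigma> = f ` \<tau>"
      then show "\<sigma> = \<tau>"
        using subset[of \<sigma> \<tau>] subset[of \<tau> \<sigma>] by (simp add: L(3) faces_def)
    qed
    ultimately show ?thesis by (simp add: card_image)
  qed
qed

lemma symmetrized_torus_cycle:
  assumes P: "octahedron n k P" and Q: "octahedron n k Q" and disj: "vertex_disjoint P Q" and k: "k \<ge> 1"
  shows "symmetric_cycle_in_U n k (symmetrized_torus P Q)"
proof -
  let ?K = "join_complex n k" and ?C = "symmetrized_torus P Q"
  have sub: "P \<subseteq> faces k ?K" "Q \<subseteq> faces k ?K"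
    using P Q by (auto simp: octahedron_def subcomplex_def faces_def)
  have disj': "\<sigma> \<inter> \<tau> = {}" if "\<sigma> \<in> P" "\<tau> \<in> Q" for \<sigma> \<tau>
    using disj that by (auto simp: vertex_disjoint_def)
  have ne: "\<sigma> \<noteq> {}" if "\<sigma> \<in> faces k ?K" for \<sigma>
    using card_face[OF that] by auto
  \<comment> \<open>A common face would be disjoint from itself, hence empty. The symmetric
    difference in the torus is therefore a plain union.\<close>
  have "\<sigma> \<notin> Q" if "\<sigma> \<in> P" for \<sigma>
    using disj'[OF that, of \<sigma>] ne[of \<sigma>] sub(1) that by auto
  then have PQ: "P \<inter> Q = {}" by blast
  have C: "?C = P \<times> Q \<union> Q \<times> P" unfolding symmetrized_torus_def using PQ by blast
  have even: "even (card {\<alpha> \<in> faces k ?K. a \<subseteq> \<alpha> \<and> (\<alpha>, \<beta>) \<in> ?C}) \<and>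
        even (card {\<alpha> \<in> faces k ?K. a \<subseteq> \<alpha> \<and> (\<beta>, \<alpha>) \<in> ?C})"
    if a: "a \<in> faces (k - 1) ?K" for a \<beta>
  proof -
    \<comment> \<open>For \<beta> in one octahedron, the faces counted are those of the other one
      that contain \<open>a\<close>.\<close>
    consider (Q) "\<beta> \<in> Q" "\<beta> \<notin> P" | (P) "\<beta> \<in> P" "\<beta> \<notin> Q" | (none) "\<beta> \<notin> P" "\<beta> \<notin> Q"
      using PQ by blast
    then show ?thesis
    proof cases
      case Q
      then have "{\<alpha> \<in> faces k ?K. a \<subseteq> \<alpha> \<and> (\<alpha>, \<beta>) \<in> ?C} = {\<alpha> \<in> P. a \<subseteq> \<alpha>}"
        "{\<alpha> \<in> faces k ?K. a \<subseteq> \<alpha> \<and> (\<beta>, \<alpha>) \<in> ?C} = {\<alpha> \<in> P. a \<subseteq> \<alpha>}"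
        unfolding C using sub(1) by blast+
      then show ?thesis using octahedron_even[OF assms(1) a k] by simp
    next
      case P
      then have "{\<alpha> \<in> faces k ?K. a \<subseteq> \<alpha> \<and> (\<alpha>, \<beta>) \<in> ?C} = {\<alpha> \<in> Q. a \<subseteq> \<alpha>}"
        "{\<alpha> \<in> faces k ?K. a \<subseteq> \<alpha> \<and> (\<beta>, \<alpha>) \<in> ?C} = {\<alpha> \<in> Q. a \<subseteq> \<alpha>}"
        unfolding C using sub(2) by blast+
      then show ?thesis using octahedron_even[OF assms(2) a k] by simp
    next
      case none
      then have "{\<alpha> \<in> faces k ?K. a \<subseteq> \<alpha> \<and> (\<alpha>, \<beta>) \<in> ?C} = {}" "{\<alpha> \<in> faces k ?K. a \<subseteq> \<alpha> \<and> (\<beta>, \<alpha>) \<in> ?C} = {}"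
        unfolding C by blast+
      then show ?thesis by (simp only: card.empty even_zero)
    qed
  qed
  have "?C \<subseteq> faces k ?K \<times> faces k ?K" unfolding C using sub by blast
  with even have "product_cycle k ?K ?C"
    unfolding product_cycle_join_complex_iff[OF k] by (intro conjI ballI) simp_all
  moreover have "?C \<subseteq> U n k"
    unfolding C U_def deleted_product_def using sub disj' by blast
  moreover have "swap_symmetric ?C"
    unfolding C swap_symmetric_def by (auto simp: image_Un product_swap)
  ultimately show ?thesis by (simp add: symmetric_cycle_in_U_def)
qed

text \<open>The faces form the join of the sets \<open>A i\<close>; relabelling each of them by
  \<open>{1..2}\<close> is the required isomorphism.\<close>

lemma octahedron_product:
  assumes A: "\<And>i. i < Suc k \<Longrightarrow> A i \<subseteq> {1..n} \<and> card (A i) = 2" and n: "n \<ge> 1"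
  shows "octahedron n k (simplex_of ` {xs. length xs = Suc k \<and> (\<forall>i<Suc k. xs ! i \<in> A i)})"
proof -
  define L where "L = {\<sigma>. \<sigma> \<noteq> {} \<and> \<sigma> \<subseteq> Sigma {0..k} A \<and> inj_on fst \<sigma>}"
  have "Sigma {0..k} A \<subseteq> {0..k} \<times> {1..n}"
    using A by (auto simp: less_Suc_eq_le subset_iff)
  then have L: "L = {\<sigma> \<in> join_complex n k. \<sigma> \<subseteq> Sigma {0..k} A}"
    unfolding L_def join_complex_eq[OF n] by blast
  have "subcomplex L (join_complex n k)"
    unfolding subcomplex_def finite_complex_def
  proof (intro conjI ballI allI impI)
    show "finite L" using finite_join_complex[of n k] by (simp add: L)
    show "finite \<sigma>" "\<sigma> \<noteq> {}" if "\<sigma> \<in> L" for \<sigma>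
      using that finite_complex_join_complex[of n k] by (simp_all add: L finite_complex_def)
    show "\<tau> \<in> L" if "\<sigma> \<in> L" "\<tau> \<subseteq> \<sigma> \<and> \<tau> \<noteq> {}" for \<sigma> \<tau>
      using that unfolding L_def by (blast intro: inj_on_subset)
  qed (simp add: L)
  moreover have "complex_isomorphic L (join_complex 2 k)"
  proof -
    have "\<exists>g. bij_betw g (A i) {1..2::nat}" if "i \<le> k" for i
      using A[of i] that by (intro finite_same_card_bij) (auto simp: card_ge_0_finite)
    then obtain g where g: "\<And>i. i \<le> k \<Longrightarrow> bij_betw (g i) (A i) {1..2::nat}" by metis
    define f where "f = (\<lambda>(i, x). (i, g i x))"
    have fst_f: "fst (f v) = fst v" for v by (simp add: f_def split: prod.split)
    have bij: "bij_betw f (Sigma {0..k} A) ({0..k} \<times> {1..2})"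
    proof (rule bij_betw_imageI)
      show "inj_on f (Sigma {0..k} A)"
        using g by (auto simp: f_def inj_on_def bij_betw_def)
      show "f ` Sigma {0..k} A = {0..k} \<times> {1..2}"
      proof (intro set_eqI iffI)
        fix v assume "v \<in> {0..k} \<times> {1..2::nat}"
        then obtain i y where v: "v = (i, y)" "i \<le> k" "y \<in> {1..2}" by auto
        then have "y \<in> g i ` A i" using g[of i] by (simp add: bij_betw_def)
        then obtain x where "x \<in> A i" "y = g i x" by blast
        then show "v \<in> f ` Sigma {0..k} A" using v by (auto simp: f_def intro!: image_eqI[of _ _ "(i, x)"])
      next
        fix v assume "v \<in> f ` Sigma {0..k} A"
        then obtain i x where v: "v = (i, g i x)" "i \<le> k" "x \<in> A i" by (auto simp: f_def)
        then show "v \<in> {0..k} \<times> {1..2}" using bij_betwE[OF g[of i]] by auto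
      qed
    qed
    have J: "join_complex 2 k = {\<sigma>. \<sigma> \<noteq> {} \<and> \<sigma> \<subseteq> {0..k} \<times> {1..2} \<and> inj_on fst \<sigma>}"
      by (rule join_complex_eq) simp
    have "\<Union>L = Sigma {0..k} A"
    proof
      show "Sigma {0..k} A \<subseteq> \<Union>L"
      proof
        fix v assume "v \<in> Sigma {0..k} A"
        then have "{v} \<in> L" by (simp add: L_def)
        then show "v \<in> \<Union>L" by blast
      qed
    qed (auto simp: L_def)
    moreover have "\<Union>(join_complex 2 k) = {0..k} \<times> {1..2}"
    proof
      show "{0..k} \<times> {1..2} \<subseteq> \<Union>(join_complex 2 k)"
      proof
        fix v assume "v \<in> {0..k} \<times> {1..2::nat}"
        then have "{v} \<in> join_complex 2 k" by (simp add: J)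
        then show "v \<in> \<Union>(join_complex 2 k)" by blast
      qed
    qed (auto simp: J)
    moreover have "(\<lambda>\<sigma>. f ` \<sigma>) ` L = join_complex 2 k"
    proof (intro set_eqI iffI)
      fix \<sigma> assume "\<sigma> \<in> (\<lambda>\<sigma>. f ` \<sigma>) ` L"
      then obtain \<rho> where \<rho>: "\<sigma> = f ` \<rho>" "\<rho> \<noteq> {}" "\<rho> \<subseteq> Sigma {0..k} A" "inj_on fst \<rho>"
        by (auto simp: L_def)
      have "inj_on fst \<sigma>"
        using \<rho>(4) unfolding \<rho>(1) inj_on_def by (auto simp: fst_f)
      moreover have "\<sigma> \<subseteq> {0..k} \<times> {1..2}"
        using bij \<rho>(1,3) by (auto simp: bij_betw_def)
      ultimately show "\<sigma> \<in> join_complex 2 k" using \<rho> by (simp add: J)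
    next
      fix \<sigma> assume "\<sigma> \<in> join_complex 2 k"
      then have \<sigma>: "\<sigma> \<noteq> {}" "\<sigma> \<subseteq> {0..k} \<times> {1..2}" "inj_on fst \<sigma>" by (simp_all add: J)
      \<comment> \<open>The preimage is taken inside the vertex set on which \<open>f\<close> is
        injective; since \<open>f\<close> keeps first coordinates, it again has at most one vertex
        per coordinate.\<close>
      let ?\<rho> = "{v \<in> Sigma {0..k} A. f v \<in> \<sigma>}"
      have "\<sigma> \<subseteq> f ` Sigma {0..k} A" using \<sigma>(2) bij by (simp add: bij_betw_def)
      then have im: "f ` ?\<rho> = \<sigma>" by blast
      have "inj_on fst ?\<rho>"
      proof (rule inj_onI)
        fix u v assume uv: "u \<in> ?\<rho>" "v \<in> ?\<rho>" "fst u = fst v"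
        then have "f u = f v" using \<sigma>(3) fst_f by (auto simp: inj_on_def)
        then show "u = v" using bij uv by (auto simp: bij_betw_def inj_on_def)
      qed
      then have "?\<rho> \<in> L" using im \<sigma>(1) by (auto simp: L_def)
      then have "f ` ?\<rho> \<in> (\<lambda>\<sigma>. f ` \<sigma>) ` L" by (rule imageI)
      then show "\<sigma> \<in> (\<lambda>\<sigma>. f ` \<sigma>) ` L" unfolding im .
    qed
    ultimately show ?thesis
      unfolding complex_isomorphic_def using bij by auto
  qed
  moreover have "faces k L = simplex_of ` {xs. length xs = Suc k \<and> (\<forall>i<Suc k. xs ! i \<in> A i)}"
  proof -
    have "faces k L = {\<sigma> \<in> faces k (join_complex n k). \<sigma> \<subseteq> Sigma {0..k} A}"
      by (auto simp: faces_def L)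
    also have "\<dots> = simplex_of ` {xs. length xs = Suc k \<and> set xs \<subseteq> {1..n} \<and> simplex_of xs \<subseteq> Sigma {0..k} A}"
      unfolding faces_join_complex[OF n] by blast
    also have "{xs. length xs = Suc k \<and> set xs \<subseteq> {1..n} \<and> simplex_of xs \<subseteq> Sigma {0..k} A} =
        {xs. length xs = Suc k \<and> (\<forall>i<Suc k. xs ! i \<in> A i)}"
    proof (intro Collect_cong conj_cong refl)
      fix xs :: "nat list" assume len: "length xs = Suc k"
      have "simplex_of xs \<subseteq> Sigma {0..k} A \<longleftrightarrow> (\<forall>i<Suc k. xs ! i \<in> A i)"
        using len by (simp add: simplex_of_def image_subset_iff Ball_def less_Suc_eq_le)
      moreover have "set xs \<subseteq> {1..n}" if "\<forall>i<Suc k. xs ! i \<in> A i"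
        using that A len by (metis in_set_conv_nth subset_iff)
      ultimately show "set xs \<subseteq> {1..n} \<and> simplex_of xs \<subseteq> Sigma {0..k} A \<longleftrightarrow> (\<forall>i<Suc k. xs ! i \<in> A i)"
        by blast
    qed
    finally show ?thesis .
  qed
  ultimately show ?thesis unfolding octahedron_def by metis
qed

section \<open>Tori of words as products of octahedra\<close>

lemma tori_eq_product:
  assumes "T \<in> tori n m"
  shows "\<exists>A B. (\<forall>i<m. A i \<subseteq> {1..n} \<and> card (A i) = 2 \<and> B i \<subseteq> {1..n} \<and> card (B i) = 2 \<and> A i \<inter> B i = {}) \<and>
    T = {w. length w = m \<and> (\<forall>i<m. w ! i \<in> A i \<times> B i)}"
  using assms
proof (induction m arbitrary: T)
  case 0
  then show ?case by auto
next
  case (Suc m)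
  then obtain S D where T: "T = cons_prod S D" "S \<in> squares n" "D \<in> tori n m" by auto
  from Suc.IH[OF T(3)] obtain A B where
    AB: "\<forall>i<m. A i \<subseteq> {1..n} \<and> card (A i) = 2 \<and> B i \<subseteq> {1..n} \<and> card (B i) = 2 \<and> A i \<inter> B i = {}"
    and D: "D = {w. length w = m \<and> (\<forall>i<m. w ! i \<in> A i \<times> B i)}" by blast
  from T(2) obtain p q u v where S: "S = {p, q} \<times> {u, v}" "{p, q, u, v} \<subseteq> {1..n}" "p \<noteq> q" "u \<noteq> v"
      "{p, q} \<inter> {u, v} = {}" unfolding squares_def by blast
  \<comment> \<open>\<open>case_nat\<close> puts the new pair of sets at position 0 and shifts the
    others by one.\<close>
  have "T = {w. length w = Suc m \<and> (\<forall>i<Suc m. w ! i \<in> case_nat {p, q} A i \<times> case_nat {u, v} B i)}"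
    by (rule list_set_eqI) (auto simp: T(1) S(1) D All_less_Suc2)
  then show ?case
    using AB S(2-5) by (intro exI[of _ "case_nat {p, q} A"] exI[of _ "case_nat {u, v} B"])
      (simp add: All_less_Suc2)
qed

text \<open>Letters in \<open>A i \<times> B i\<close> mean that the two faces are chosen
  independently, which gives a product of octahedra; \<open>flip\<close> exchanges its
  factors.\<close>

lemma cell_image_symmetrize_torus:
  assumes T: "T \<in> tori n (Suc k)" and n: "n \<ge> 1"
  shows "cell_of ` symmetrize T \<in> basic_cycles n k"
proof -
  obtain A B where
    AB: "\<And>i. i < Suc k \<Longrightarrow> A i \<subseteq> {1..n} \<and> card (A i) = 2 \<and> B i \<subseteq> {1..n} \<and> card (B i) = 2 \<and> A i \<inter> B i = {}"
    and T_eq: "T = {w. length w = Suc k \<and> (\<forall>i<Suc k. w ! i \<in> A i \<times> B i)}"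
    using tori_eq_product[OF T] by blast
  let ?X = "\<lambda>A. simplex_of ` {xs. length xs = Suc k \<and> (\<forall>i<Suc k. xs ! i \<in> A i)}"
  have cell: "cell_of ` T = ?X A \<times> ?X B"
  proof (intro set_eqI iffI)
    fix c assume "c \<in> cell_of ` T"
    then show "c \<in> ?X A \<times> ?X B" by (auto simp: T_eq cell_of_def mem_Times_iff)
  next
    fix c assume "c \<in> ?X A \<times> ?X B"
    then obtain xs ys where "c = (simplex_of xs, simplex_of ys)" "length xs = Suc k" "length ys = Suc k"
      "\<forall>i<Suc k. xs ! i \<in> A i" "\<forall>i<Suc k. ys ! i \<in> B i" by auto
    then show "c \<in> cell_of ` T" by (simp add: simplex_pair_in_cell_image_iff T_eq)
  qed
  have "cell_of ` symmetrize T = sym_diff (cell_of ` T) (prod.swap ` cell_of ` T)"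
    unfolding symmetrize_def swap_cell_of_image image_Un image_set_diff[OF inj_cell_of] ..
  also have "\<dots> = symmetrized_torus (?X A) (?X B)"
    unfolding cell symmetrized_torus_def product_swap ..
  finally have "cell_of ` symmetrize T = symmetrized_torus (?X A) (?X B)" .
  moreover have "octahedron n k (?X A)" "octahedron n k (?X B)"
    by (rule octahedron_product[OF _ n]; use AB in blast)+
  moreover have "vertex_disjoint (?X A) (?X B)"
    unfolding vertex_disjoint_def using AB by (fastforce simp: simplex_of_def)
  ultimately show ?thesis unfolding basic_cycles_def by blast
qed

section \<open>Back from words to cells of the join complex\<close>

lemma words_mono:
  assumes "n \<le> n'"
  shows "words n m \<subseteq> words n' m"
proof -
  have "arcs n \<subseteq> arcs n'" using assms by (auto simp: arcs_def)
  then show ?thesis unfolding words_def by blast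
qed

lemma flip_words: "flip (words n m) = words n m"
proof -
  have "prod.swap e \<in> arcs n \<longleftrightarrow> e \<in> arcs n" for e by (cases e) auto
  then have "prod.swap ` set w \<subseteq> arcs n \<longleftrightarrow> set w \<subseteq> arcs n" for w
    unfolding subset_eq ball_simps by simp
  then show ?thesis by (simp add: flip_def words_def)
qed

theorem theorem3p2:
  fixes k n :: nat
  assumes "k \<ge> 1" and "n \<ge> 3"
  shows "(\<forall>P Q. octahedron n k P \<and> octahedron n k Q \<and> vertex_disjoint P Q \<longrightarrow>
            symmetric_cycle_in_U n k (symmetrized_torus P Q)) \<and>
         symmetric_cycle_in_U n k (U 3 k) \<and>
         (\<forall>C. symmetric_cycle_in_U n k C \<longrightarrow>
            (\<exists>F. finite F \<and> F \<subseteq> basic_cycles n k \<and> C = mod2_sum F))"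
proof (intro conjI allI impI)
  show "symmetric_cycle_in_U n k (symmetrized_torus P Q)"
    if "octahedron n k P \<and> octahedron n k Q \<and> vertex_disjoint P Q" for P Q
    by (rule symmetrized_torus_cycle) (use assms(1) that in simp_all)
next
  have U3: "U 3 k = cell_of ` words 3 (Suc k)" by (rule U_eq_cell_image) simp
  have "product_cycle k (join_complex n k) (U 3 k)"
    unfolding U3 using assms words_mono[OF assms(2), of "Suc k"]
    by (subst product_cycle_cell_image_iff) (simp_all add: tensor_cycle_words3)
  moreover have "U 3 k \<subseteq> U n k"
    using U3 U_eq_cell_image[of n k] words_mono[OF assms(2), of "Suc k"] assms(2) by auto
  moreover have "swap_symmetric (U 3 k)"
    unfolding U3 swap_symmetric_def swap_cell_of_image flip_words ..
  ultimately show "symmetric_cycle_in_U n k (U 3 k)" by (simp add: symmetric_cycle_in_U_def)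
next
  fix C assume "symmetric_cycle_in_U n k C"
  then have C: "product_cycle k (join_complex n k) C" "C \<subseteq> U n k" "prod.swap ` C = C"
    by (simp_all add: symmetric_cycle_in_U_def swap_symmetric_def)
  then obtain D where D: "D \<subseteq> words n (Suc k)" "C = cell_of ` D"
    using U_eq_cell_image[of n k] assms(2) by (auto simp: subset_image_iff)
  have "tensor_cycle n (Suc k) D"
    using C(1) D assms product_cycle_cell_image_iff by auto
  moreover have "flip D = D"
    using C(3) unfolding D(2) swap_cell_of_image by (simp add: inj_image_eq_iff[OF inj_cell_of])
  ultimately have "D \<in> mod2_span (symmetrize ` tori n (Suc k) \<union> {words 3 (Suc k)})"
    using symmetric_tensor_cycle_in_span assms(2) by blast
  then have "cell_of ` D \<in> mod2_span (basic_cycles n k)"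
  \<comment> \<open>Injectivity of \<open>cell_of\<close> makes taking images additive. Generators
    then go to symmetrized tori and to \<open>U 3 k\<close>.\<close>
  proof (rule mod2_span_map[where L = "image cell_of"])
    fix b assume "b \<in> symmetrize ` tori n (Suc k) \<union> {words 3 (Suc k)}"
    then consider T where "T \<in> tori n (Suc k)" "b = symmetrize T" | "b = words 3 (Suc k)"
      by blast
    then have "cell_of ` b \<in> basic_cycles n k"
    proof cases
      case 1
      then show ?thesis using cell_image_symmetrize_torus assms(2) by simp
    next
      case 2
      then show ?thesis using U_eq_cell_image[of 3 k] by (simp add: basic_cycles_def)
    qed
    then show "cell_of ` b \<in> mod2_span (basic_cycles n k)" by (rule mod2_span_base)
  qed (simp_all add: image_Un image_set_diff[OF inj_cell_of])
  then show "\<exists>F. finite F \<and> F \<subseteq> basic_cycles n k \<and> C = mod2_sum F"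
    unfolding D(2) by (rule mod2_span_imp_mod2_sum)
qed

end
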